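(* Let $K$ be a field of characteristic $0$, let $m\ge 2$ be an integer and $k$ a positive integer, and let $\mathfrak n_{m,k}$ be the free $k$-step nilpotent Lie algebra over $K$ in $m$ generators. Then $\mathfrak n_{m,k}$ admits an ad-invariant metric if and only if $(m,k)=(3,2)$ or $(m,k)=(2,3)$.
   Context: An ad-invariant metric on a Lie algebra $\mathfrak g$ over $K$ is a nondegenerate symmetric $K$-bilinear form $\langle\,,\,\rangle$ on $\mathfrak g$ (with values in $K$, no definiteness required) such that $\langle [x,y],z\rangle+\langle y,[x,z]\rangle=0$ for all $x,y,z\in\mathfrak g$. The central descending series of $\mathfrak g$ is $C^0(\mathfrak g)=\mathfrak g$, $C^r(\mathfrak g)=[\mathfrak g,C^{r-1}(\mathfrak g)]$ for $r\ge 1$. A Lie algebra $\mathfrak g$ is $k$-step nilpotent if $C^k(\mathfrak g)=0$ and $C^{k-1}(\mathfrak g)\neq 0$. Let $\mathfrak f_m$ be the free Lie algebra over $K$ on $m$ generators. The free $k$-step nilpotent Lie algebra on $m$ generators is $\mathfrak n_{m,k}=\mathfrak f_m/C^{k}(\mathfrak f_m)$.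
   Formalization: The formal theorem assumes k ≥ 2 instead of k positive: for k = 1 the algebra n_{m,1} is abelian, so the standard dot product is an ad-invariant metric and the stated equivalence fails for every m ≥ 2. *)

theory Defs
  imports "HOL-Library.Poly_Mapping"
begin

section \<open>Lie algebras over a field\<close>

record ('k, 'a) alg =
  carrier :: "'a set"
  zero :: 'a
  add :: "'a \<Rightarrow> 'a \<Rightarrow> 'a"
  smul :: "'k \<Rightarrow> 'a \<Rightarrow> 'a"
  bracket :: "'a \<Rightarrow> 'a \<Rightarrow> 'a"

text \<open>A vector space with a bilinear product, written as a bracket; no further identities.\<close>

locale nonassoc_algebra =
  fixes A :: "('k::field, 'a) alg"
  assumes zero_closed: "zero A \<in> carrier A"
    and add_closed: "\<lbrakk>x \<in> carrier A; y \<in> carrier A\<rbrakk> \<Longrightarrow> add A x y \<in> carrier A"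
    and smul_closed: "x \<in> carrier A \<Longrightarrow> smul A c x \<in> carrier A"
    and bracket_closed: "\<lbrakk>x \<in> carrier A; y \<in> carrier A\<rbrakk> \<Longrightarrow> bracket A x y \<in> carrier A"
    and add_assoc: "\<lbrakk>x \<in> carrier A; y \<in> carrier A; z \<in> carrier A\<rbrakk>
      \<Longrightarrow> add A (add A x y) z = add A x (add A y z)"
    and add_commute: "\<lbrakk>x \<in> carrier A; y \<in> carrier A\<rbrakk> \<Longrightarrow> add A x y = add A y x"
    and add_zero: "x \<in> carrier A \<Longrightarrow> add A x (zero A) = x"
    and add_inverse: "x \<in> carrier A \<Longrightarrow> \<exists>y\<in>carrier A. add A x y = zero A"
    and smul_add: "\<lbrakk>x \<in> carrier A; y \<in> carrier A\<rbrakk>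
      \<Longrightarrow> smul A c (add A x y) = add A (smul A c x) (smul A c y)"
    and add_smul: "x \<in> carrier A \<Longrightarrow> smul A (c + d) x = add A (smul A c x) (smul A d x)"
    and smul_smul: "x \<in> carrier A \<Longrightarrow> smul A c (smul A d x) = smul A (c * d) x"
    and one_smul: "x \<in> carrier A \<Longrightarrow> smul A 1 x = x"
    and bracket_add_left: "\<lbrakk>x \<in> carrier A; y \<in> carrier A; z \<in> carrier A\<rbrakk>
      \<Longrightarrow> bracket A (add A x y) z = add A (bracket A x z) (bracket A y z)"
    and bracket_add_right: "\<lbrakk>x \<in> carrier A; y \<in> carrier A; z \<in> carrier A\<rbrakk>
      \<Longrightarrow> bracket A x (add A y z) = add A (bracket A x y) (bracket A x z)"
    and bracket_smul_left: "\<lbrakk>x \<in> carrier A; y \<in> carrier A\<rbrakk>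
      \<Longrightarrow> bracket A (smul A c x) y = smul A c (bracket A x y)"
    and bracket_smul_right: "\<lbrakk>x \<in> carrier A; y \<in> carrier A\<rbrakk>
      \<Longrightarrow> bracket A x (smul A c y) = smul A c (bracket A x y)"

definition jacobiator :: "('k, 'a) alg \<Rightarrow> 'a \<Rightarrow> 'a \<Rightarrow> 'a \<Rightarrow> 'a" where
  "jacobiator A x y z = add A (bracket A x (bracket A y z))
     (add A (bracket A y (bracket A z x)) (bracket A z (bracket A x y)))"

locale lie_algebra = nonassoc_algebra A for A :: "('k::field, 'a) alg" +
  assumes alternating: "x \<in> carrier A \<Longrightarrow> bracket A x x = zero A"
    and jacobi: "\<lbrakk>x \<in> carrier A; y \<in> carrier A; z \<in> carrier A\<rbrakk>
      \<Longrightarrow> jacobiator A x y z = zero A"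

definition ad_invariant_metric :: "('k::field, 'a) alg \<Rightarrow> ('a \<Rightarrow> 'a \<Rightarrow> 'k) \<Rightarrow> bool" where
  "ad_invariant_metric A B \<longleftrightarrow>
     (\<forall>x\<in>carrier A. \<forall>y\<in>carrier A. \<forall>z\<in>carrier A. B (add A x y) z = B x z + B y z) \<and>
     (\<forall>c. \<forall>x\<in>carrier A. \<forall>y\<in>carrier A. B (smul A c x) y = c * B x y) \<and>
     (\<forall>x\<in>carrier A. \<forall>y\<in>carrier A. B x y = B y x) \<and>
     (\<forall>x\<in>carrier A. (\<forall>y\<in>carrier A. B x y = 0) \<longrightarrow> x = zero A) \<and>
     (\<forall>x\<in>carrier A. \<forall>y\<in>carrier A. \<forall>z\<in>carrier A.
        B (bracket A x y) z + B y (bracket A x z) = 0)"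

definition admits_ad_invariant_metric :: "('k::field, 'a) alg \<Rightarrow> bool" where
  "admits_ad_invariant_metric A \<longleftrightarrow> (\<exists>B. ad_invariant_metric A B)"

section \<open>Subspaces, ideals and quotients\<close>

definition lin_subspace :: "('k, 'a) alg \<Rightarrow> 'a set \<Rightarrow> bool" where
  "lin_subspace A W \<longleftrightarrow> W \<subseteq> carrier A \<and> zero A \<in> W \<and>
     (\<forall>x\<in>W. \<forall>y\<in>W. add A x y \<in> W) \<and> (\<forall>c. \<forall>x\<in>W. smul A c x \<in> W)"

definition lin_span :: "('k, 'a) alg \<Rightarrow> 'a set \<Rightarrow> 'a set" where
  "lin_span A S = \<Inter>{W. lin_subspace A W \<and> S \<subseteq> W}"

definition alg_ideal :: "('k, 'a) alg \<Rightarrow> 'a set \<Rightarrow> bool" where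
  "alg_ideal A I \<longleftrightarrow> lin_subspace A I \<and>
     (\<forall>x\<in>carrier A. \<forall>y\<in>I. bracket A x y \<in> I \<and> bracket A y x \<in> I)"

definition ideal_generated :: "('k, 'a) alg \<Rightarrow> 'a set \<Rightarrow> 'a set" where
  "ideal_generated A S = \<Inter>{I. alg_ideal A I \<and> S \<subseteq> I}"

definition coset :: "('k, 'a) alg \<Rightarrow> 'a set \<Rightarrow> 'a \<Rightarrow> 'a set" where
  "coset A I x = add A x ` I"

definition quotient_alg :: "('k, 'a) alg \<Rightarrow> 'a set \<Rightarrow> ('k, 'a set) alg" where
  "quotient_alg A I = \<lparr>
     carrier = coset A I ` carrier A,
     zero = I,
     add = (\<lambda>X Y. \<Union>x\<in>X. \<Union>y\<in>Y. coset A I (add A x y)),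
     smul = (\<lambda>c X. \<Union>x\<in>X. coset A I (smul A c x)),
     bracket = (\<lambda>X Y. \<Union>x\<in>X. \<Union>y\<in>Y. coset A I (bracket A x y))\<rparr>"

primrec central_descending :: "('k, 'a) alg \<Rightarrow> nat \<Rightarrow> 'a set" where
  "central_descending A 0 = carrier A"
| "central_descending A (Suc r) =
     lin_span A {bracket A x y | x y. x \<in> carrier A \<and> y \<in> central_descending A r}"

section \<open>Free Lie algebras\<close>

text \<open>
  The free Lie algebra on a set \<open>X\<close> is the free nonassociative algebra on \<open>X\<close> (formal linear
  combinations of binary trees with leaves in \<open>X\<close>) modulo the ideal generated by all squares
  and all Jacobi expressions.
\<close>

datatype (leaves: 'x) magma = Gen 'x | Prod "'x magma" "'x magma"

definition magma_mult ::
  "('x magma \<Rightarrow>\<^sub>0 'k::field) \<Rightarrow> ('x magma \<Rightarrow>\<^sub>0 'k) \<Rightarrow> ('x magma \<Rightarrow>\<^sub>0 'k)" where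
  "magma_mult f g = (\<Sum>s\<in>Poly_Mapping.keys f. \<Sum>t\<in>Poly_Mapping.keys g.
     Poly_Mapping.single (Prod s t) (Poly_Mapping.lookup f s * Poly_Mapping.lookup g t))"

definition free_nonassoc :: "'x set \<Rightarrow> ('k::field, 'x magma \<Rightarrow>\<^sub>0 'k) alg" where
  "free_nonassoc X = \<lparr>
     carrier = {f. \<forall>t\<in>Poly_Mapping.keys f. leaves t \<subseteq> X},
     zero = 0,
     add = (+),
     smul = (\<lambda>c. Poly_Mapping.map ((*) c)),
     bracket = magma_mult\<rparr>"

definition lie_relations :: "('k, 'a) alg \<Rightarrow> 'a set" where
  "lie_relations A = {bracket A x x | x. x \<in> carrier A} \<union>
     {jacobiator A x y z | x y z. x \<in> carrier A \<and> y \<in> carrier A \<and> z \<in> carrier A}"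

definition free_lie :: "'x set \<Rightarrow> ('k::field, ('x magma \<Rightarrow>\<^sub>0 'k) set) alg" where
  "free_lie X = quotient_alg (free_nonassoc X)
     (ideal_generated (free_nonassoc X) (lie_relations (free_nonassoc X)))"

text \<open>
  For \<open>k = 1\<close> the algebra below is abelian, so every nondegenerate symmetric bilinear form on it
  is ad-invariant; the classification of those admitting an ad-invariant metric concerns \<open>k \<ge> 2\<close>.
\<close>

definition free_nilpotent ::
  "nat \<Rightarrow> nat \<Rightarrow> ('k::field, (nat magma \<Rightarrow>\<^sub>0 'k) set set) alg" where
  "free_nilpotent m k = quotient_alg (free_lie {..<m}) (central_descending (free_lie {..<m}) k)"

section \<open>The free nilpotent Lie algebras are Lie algebras\<close>

lemma UN_const_eq: "x \<in> S \<Longrightarrow> (\<And>u. u \<in> S \<Longrightarrow> f u = T) \<Longrightarrow> (\<Union>u\<in>S. f u) = T"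
  by auto

lemma UN2_const_eq: "x \<in> S \<Longrightarrow> y \<in> S' \<Longrightarrow> (\<And>u v. u \<in> S \<Longrightarrow> v \<in> S' \<Longrightarrow> f u v = T)
    \<Longrightarrow> (\<Union>u\<in>S. \<Union>v\<in>S'. f u v) = T"
  by (meson UN_const_eq)

lemma lin_subspace_lin_span: "S \<subseteq> carrier A \<Longrightarrow> nonassoc_algebra A \<Longrightarrow> lin_subspace A (lin_span A S)"
  unfolding lin_span_def lin_subspace_def
  apply (auto simp: nonassoc_algebra.zero_closed nonassoc_algebra.add_closed nonassoc_algebra.smul_closed)
  done

context nonassoc_algebra begin

lemma zero_add: "x \<in> carrier A \<Longrightarrow> add A (zero A) x = x"
  by (metis add_commute add_zero zero_closed)

lemma add_cancel: "\<lbrakk>x \<in> carrier A; y \<in> carrier A; z \<in> carrier A; add A x y = add A x z\<rbrakk> \<Longrightarrow> y = z"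
  by (metis add_assoc add_commute add_inverse zero_add)

lemma zero_smul: "x \<in> carrier A \<Longrightarrow> smul A 0 x = zero A"
  by (metis add_cancel add_smul add_zero smul_closed zero_closed add.right_neutral)

lemma smul_zero: "smul A c (zero A) = zero A"
  by (metis add_cancel smul_add add_zero smul_closed zero_closed)

lemma add_neg: "x \<in> carrier A \<Longrightarrow> add A x (smul A (-1) x) = zero A"
  by (metis add_smul one_smul zero_smul add.right_inverse)

lemma bracket_zero_left: "x \<in> carrier A \<Longrightarrow> bracket A (zero A) x = zero A"
  by (metis bracket_smul_left zero_smul zero_closed bracket_closed)
lemma bracket_zero_right: "x \<in> carrier A \<Longrightarrow> bracket A x (zero A) = zero A"
  by (metis bracket_smul_right zero_smul zero_closed bracket_closed)

lemma add_left_commute: "\<lbrakk>x \<in> carrier A; y \<in> carrier A; z \<in> carrier A\<rbrakk> \<Longrightarrow> add A x (add A y z) = add A y (add A x z)"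
  by (metis add_assoc add_commute)

lemmas ac = add_assoc add_commute add_left_commute

lemma subspace_carrier: "lin_subspace A (carrier A)"
  unfolding lin_subspace_def by (auto simp: zero_closed add_closed smul_closed)

lemma ideal_carrier: "alg_ideal A (carrier A)"
  unfolding alg_ideal_def by (auto simp: subspace_carrier bracket_closed)

lemma ideal_generated_ideal: "S \<subseteq> carrier A \<Longrightarrow> alg_ideal A (ideal_generated A S)"
  using ideal_carrier unfolding ideal_generated_def alg_ideal_def lin_subspace_def 
  by (auto 5 2)

end

locale alg_with_ideal = nonassoc_algebra + fixes I assumes I: "alg_ideal A I"
begin

lemma Isub: "x \<in> I \<Longrightarrow> x \<in> carrier A"
  and Izero: "zero A \<in> I"
  and Iadd: "\<lbrakk>x \<in> I; y \<in> I\<rbrakk> \<Longrightarrow> add A x y \<in> I"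
  and Ismul: "x \<in> I \<Longrightarrow> smul A c x \<in> I"
  and Ibr1: "\<lbrakk>x \<in> carrier A; y \<in> I\<rbrakk> \<Longrightarrow> bracket A x y \<in> I"
  and Ibr2: "\<lbrakk>x \<in> carrier A; y \<in> I\<rbrakk> \<Longrightarrow> bracket A y x \<in> I"
  using I unfolding alg_ideal_def lin_subspace_def by auto

lemma coset_add_I: assumes "x \<in> carrier A" "i \<in> I" shows "coset A I (add A x i) = coset A I x"
proof (rule set_eqI, rule iffI)
  fix z assume "z \<in> coset A I (add A x i)"
  then obtain j where "j \<in> I" "z = add A (add A x i) j" unfolding coset_def by auto
  then show "z \<in> coset A I x" unfolding coset_def using assms Isub Iadd by (auto simp: add_assoc)
next
  fix z assume "z \<in> coset A I x"
  then obtain j where j: "j \<in> I" "z = add A x j" unfolding coset_def by auto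
  have "z = add A (add A x i) (add A (smul A (-1) i) j)"
    using j assms Isub Ismul Iadd 
    by (metis add_assoc add_neg add_zero zero_add smul_closed add_closed)
  then show "z \<in> coset A I (add A x i)" unfolding coset_def using j assms Ismul Iadd by auto
qed

lemma coset_self: "x \<in> carrier A \<Longrightarrow> x \<in> coset A I x"
  unfolding coset_def using add_zero Izero by force

lemma coset_eq_zero: "x \<in> carrier A \<Longrightarrow> coset A I x = I \<longleftrightarrow> x \<in> I"
  by (metis coset_self coset_add_I zero_add coset_def image_cong image_ident zero_closed Isub)

lemma coset_zero: "coset A I (zero A) = I" by (simp add: coset_eq_zero zero_closed Izero)

lemma q_add: assumes "x \<in> carrier A" "y \<in> carrier A"
  shows "add (quotient_alg A I) (coset A I x) (coset A I y) = coset A I (add A x y)"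
proof -
  have "coset A I (add A u v) = coset A I (add A x y)" if "u \<in> coset A I x" "v \<in> coset A I y" for u v
  proof -
    from that obtain i j where ij: "i \<in> I" "j \<in> I" "u = add A x i" "v = add A y j" unfolding coset_def by auto
    then have "add A u v = add A (add A x y) (add A i j)" using assms Isub
      by (simp add: ac add_closed)
    then show ?thesis using ij assms coset_add_I by (simp add: add_closed Iadd)
  qed
  then show ?thesis unfolding quotient_alg_def alg.simps
    by (intro UN2_const_eq[OF coset_self coset_self] assms)
qed

lemma q_smul: assumes "x \<in> carrier A"
  shows "smul (quotient_alg A I) c (coset A I x) = coset A I (smul A c x)"
proof -
  have "coset A I (smul A c u) = coset A I (smul A c x)" if "u \<in> coset A I x" for u
    using that assms by (auto simp: coset_def[of A I x] smul_add Isub coset_add_I smul_closed Ismul)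
  then show ?thesis unfolding quotient_alg_def alg.simps
    by (intro UN_const_eq[OF coset_self] assms)
qed

lemma q_bracket: assumes "x \<in> carrier A" "y \<in> carrier A"
  shows "bracket (quotient_alg A I) (coset A I x) (coset A I y) = coset A I (bracket A x y)"
proof -
  have "coset A I (bracket A u v) = coset A I (bracket A x y)" if "u \<in> coset A I x" "v \<in> coset A I y" for u v
  proof -
    from that obtain i j where ij: "i \<in> I" "j \<in> I" "u = add A x i" "v = add A y j" unfolding coset_def by auto
    then have "bracket A u v = add A (bracket A x y) (add A (bracket A x j) (add A (bracket A i y) (bracket A i j)))" using assms Isub
      by (simp add: ac add_closed bracket_add_left bracket_add_right bracket_closed)
    then show ?thesis using ij assms coset_add_I by (simp add: bracket_closed Iadd Ibr1 Ibr2 Isub)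
  qed
  then show ?thesis unfolding quotient_alg_def alg.simps
    by (intro UN2_const_eq[OF coset_self coset_self] assms)
qed

lemma q_carrier: "carrier (quotient_alg A I) = coset A I ` carrier A"
  by (simp add: quotient_alg_def)
lemma q_zero: "zero (quotient_alg A I) = coset A I (zero A)"
  by (simp add: quotient_alg_def coset_zero)

lemmas q = q_carrier q_zero q_add q_smul q_bracket 

lemma q_alg: "nonassoc_algebra (quotient_alg A I)"
proof (unfold_locales, goal_cases)
  case (8 x)
  then show ?case apply (auto simp: q) 
    by (metis add_inverse q_add)
qed (auto simp: q zero_closed add_closed smul_closed bracket_closed ac add_zero
   smul_add add_smul smul_smul one_smul bracket_add_left bracket_add_right
   bracket_smul_left bracket_smul_right)

lemma q_jac: "x \<in> carrier A \<Longrightarrow> y \<in> carrier A \<Longrightarrow> z \<in> carrier A \<Longrightarrow> 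
  jacobiator (quotient_alg A I) (coset A I x) (coset A I y) (coset A I z) = coset A I (jacobiator A x y z)"
  by (simp add: jacobiator_def q bracket_closed add_closed)

lemma q_lie: assumes "lie_relations A \<subseteq> I" shows "lie_algebra (quotient_alg A I)"
proof -
  interpret Q: nonassoc_algebra "quotient_alg A I" by (rule q_alg)
  show ?thesis
  proof (unfold_locales, goal_cases)
    case (1 x)
    then obtain a where a: "a \<in> carrier A" "x = coset A I a" by (auto simp: q)
    then have "bracket A a a \<in> I" using assms unfolding lie_relations_def by blast
    with a show ?case by (simp add: q q_zero coset_zero coset_eq_zero bracket_closed)
  next
    case (2 x y z)
    then obtain a b c where "a \<in> carrier A" "b \<in> carrier A" "c \<in> carrier A" "x = coset A I a" "y = coset A I b" "z = coset A I c"
      by (auto simp: q)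
    moreover from this have "jacobiator A a b c \<in> I" using assms unfolding lie_relations_def by blast
    ultimately show ?case by (simp add: q_jac q_zero coset_zero coset_eq_zero Isub)
  qed
qed
end

lemma lie_relations_carrier: "nonassoc_algebra A \<Longrightarrow> lie_relations A \<subseteq> carrier A"
  unfolding lie_relations_def jacobiator_def
  by (auto simp: nonassoc_algebra.bracket_closed nonassoc_algebra.add_closed)

context lie_algebra begin
lemma lie_rel0: "lie_relations A \<subseteq> {zero A}"
  unfolding lie_relations_def by (auto simp: alternating jacobi)

lemma antisym: assumes "x \<in> carrier A" "y \<in> carrier A" shows "bracket A y x = smul A (-1) (bracket A x y)"
proof -
  have "bracket A (add A x y) (add A x y) =
      add A (add A (bracket A x x) (bracket A y x)) (add A (bracket A x y) (bracket A y y))"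
    using assms by (simp only: bracket_add_left bracket_add_right bracket_closed add_closed)
  then have "add A (bracket A x y) (bracket A y x) = zero A"
    using assms alternating[OF add_closed[OF assms]] add_commute
    by (simp add: alternating bracket_closed zero_add add_zero)
  then show ?thesis using assms add_neg[of "bracket A x y"] add_cancel by (metis bracket_closed smul_closed)
qed

lemma cd_ideal: "alg_ideal A (central_descending A r)"
proof (induction r)
  case 0 then show ?case by (simp add: ideal_carrier)
next
  case (Suc r)
  let ?S = "{bracket A x y | x y. x \<in> carrier A \<and> y \<in> central_descending A r}"
  have sub: "central_descending A r \<subseteq> carrier A" using Suc unfolding alg_ideal_def lin_subspace_def by auto
  have 1: "?S \<subseteq> carrier A" using sub bracket_closed by auto
  have s: "lin_subspace A (lin_span A ?S)" by (rule lin_subspace_lin_span[OF 1 nonassoc_algebra_axioms])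
  have le: "lin_span A ?S \<subseteq> central_descending A r"
    using Suc unfolding lin_span_def alg_ideal_def by auto
  have b: "bracket A x y \<in> lin_span A ?S" if "x \<in> carrier A" "y \<in> lin_span A ?S" for x y
    using that le unfolding lin_span_def by blast
  have "bracket A y x \<in> lin_span A ?S" if "x \<in> carrier A" "y \<in> lin_span A ?S" for x y
  proof -
    have "y \<in> carrier A" using that(2) le sub by auto
    then have "bracket A y x = smul A (-1) (bracket A x y)" using antisym that(1) by blast
    then show ?thesis using s b[OF that] by (simp add: lin_subspace_def)
  qed
  then show ?case using s b by (simp add: alg_ideal_def)
qed

lemma q_lie': "alg_ideal A I \<Longrightarrow> lie_algebra (quotient_alg A I)"
  using alg_with_ideal.q_lie[of A I] lie_rel0
  by (metis alg_with_ideal.Izero alg_with_ideal.intro alg_with_ideal_axioms_def empty_subsetI insert_subset nonassoc_algebra_axioms order_trans)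
end

lemma magma_mult_superset:
  fixes f g :: "'x magma \<Rightarrow>\<^sub>0 'k::field"
  assumes "finite S" "Poly_Mapping.keys f \<subseteq> S" "finite T" "Poly_Mapping.keys g \<subseteq> T"
  shows "magma_mult f g = (\<Sum>s\<in>S. \<Sum>t\<in>T. Poly_Mapping.single (Prod s t) (Poly_Mapping.lookup f s * Poly_Mapping.lookup g t))"
proof -
  have 1: "(\<Sum>t\<in>T. Poly_Mapping.single (Prod s t) (Poly_Mapping.lookup f s * Poly_Mapping.lookup g t)) =
    (\<Sum>t\<in>Poly_Mapping.keys g. Poly_Mapping.single (Prod s t) (Poly_Mapping.lookup f s * Poly_Mapping.lookup g t))" for s
    by (rule sum.mono_neutral_right) (use assms in \<open>auto simp: in_keys_iff\<close>)
  show ?thesis unfolding 1 magma_mult_def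
    by (rule sum.mono_neutral_left) (use assms in \<open>auto simp: in_keys_iff\<close>)
qed

lemma lookup_scale: "Poly_Mapping.lookup (Poly_Mapping.map ((*) c) f) t = (c::'k::field) * Poly_Mapping.lookup f t"
  by (simp add: Poly_Mapping.map.rep_eq when_def)

lemma keys_scale: "Poly_Mapping.keys (Poly_Mapping.map ((*) (c::'k::field)) f) \<subseteq> Poly_Mapping.keys f"
  by (auto simp: in_keys_iff lookup_scale)

lemma lookup_magma_mult: "Poly_Mapping.lookup (magma_mult f g) u = (case u of Gen x \<Rightarrow> 0 | Prod s t \<Rightarrow> (Poly_Mapping.lookup f s * Poly_Mapping.lookup g t :: 'k::field))"
proof (cases u)
  case (Gen x)
  then show ?thesis by (simp add: magma_mult_def lookup_sum lookup_single when_def)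
next
  case (Prod a b)
  have "magma_mult f g = (\<Sum>s\<in>insert a (Poly_Mapping.keys f). \<Sum>t\<in>insert b (Poly_Mapping.keys g). Poly_Mapping.single (Prod s t) (Poly_Mapping.lookup f s * Poly_Mapping.lookup g t))"
    by (rule magma_mult_superset) auto
  then have "Poly_Mapping.lookup (magma_mult f g) u = (\<Sum>s\<in>insert a (Poly_Mapping.keys f). \<Sum>t\<in>insert b (Poly_Mapping.keys g). if s = a \<and> t = b then Poly_Mapping.lookup f s * Poly_Mapping.lookup g t else 0)"
    by (simp only: lookup_sum lookup_single when_def Prod magma.inject)
  also have "\<dots> = (\<Sum>s\<in>insert a (Poly_Mapping.keys f). if s = a then \<Sum>t\<in>insert b (Poly_Mapping.keys g). (if t = b then Poly_Mapping.lookup f s * Poly_Mapping.lookup g t else 0) else 0)"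
    by (intro sum.cong) auto
  also have "\<dots> = Poly_Mapping.lookup f a * Poly_Mapping.lookup g b"
    by (subst sum.delta, simp, subst sum.delta, auto)
  finally show ?thesis using Prod by simp
qed

lemma nonassoc_algebra_free_nonassoc: "nonassoc_algebra (free_nonassoc X :: ('k::field, 'x magma \<Rightarrow>\<^sub>0 'k) alg)"
proof (unfold_locales, goal_cases)
  case (2 x y) then show ?case using Poly_Mapping.keys_add[of x y] by (auto simp: free_nonassoc_def)
next case (3 x c) then show ?case using keys_scale[of c x] by (auto simp: free_nonassoc_def)
next case (4 x y) then show ?case 
    by (auto simp: free_nonassoc_def in_keys_iff Ball_def lookup_magma_mult split: magma.splits)
next case (8 x) then show ?case by (intro bexI[of _ "-x"]) (auto simp: free_nonassoc_def)
qed (auto simp: free_nonassoc_def lookup_add lookup_scale lookup_magma_mult algebra_simps intro!: poly_mapping_eqI split: magma.splits)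

lemma lie_algebra_free_lie: "lie_algebra (free_lie X :: ('k::field, ('x magma \<Rightarrow>\<^sub>0 'k) set) alg)"
proof -
  interpret F: nonassoc_algebra "free_nonassoc X :: ('k::field, 'x magma \<Rightarrow>\<^sub>0 'k) alg" by (rule nonassoc_algebra_free_nonassoc)
  interpret J: alg_with_ideal "free_nonassoc X :: ('k::field, 'x magma \<Rightarrow>\<^sub>0 'k) alg" "ideal_generated (free_nonassoc X) (lie_relations (free_nonassoc X))"
    by unfold_locales (intro F.ideal_generated_ideal lie_relations_carrier nonassoc_algebra_free_nonassoc)
  show ?thesis unfolding free_lie_def by (rule J.q_lie) (auto simp: ideal_generated_def)
qed

theorem lie_algebra_free_nilpotent:
  "lie_algebra (free_nilpotent m k :: ('k::field, _) alg)"
  unfolding free_nilpotent_def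
  by (intro lie_algebra.q_lie' lie_algebra.cd_ideal lie_algebra_free_lie)

end

(*
  The centre of n_{m,k} contains its last term C^{k-1}, which by invariance is orthogonal to all
  brackets. So an element z of C^{k-1} is determined by its products with the m generators, and a
  metric forces dim C^{k-1} <= m. Except for (3,2), (2,3) and (2,2) there are more than m
  right-normed brackets of pairwise distinct multidegree in C^{k-1}; they are independent because
  their images in the free associative algebra do not vanish. For (2,2), [x,y] is orthogonal to x
  and to y.

  Conversely, coordinates on n_{3,2} and n_{2,3} are read off as coefficients of short words in
  the free associative algebra. The metrics are the polarisations of the identifications
  [x_i,x_j] = dual of x_k (i,j,k cyclic) on n_{3,2}, and <[x,y],[x,y]> = 1, <x,[y,[x,y]]> = 1,
  <y,[x,[x,y]]> = -1 on n_{2,3}.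
*)
theory Submission
  imports Defs "HOL-Library.Multiset"
begin

section \<open>Words in the free associative algebra\<close>

text \<open>Elements of n_{m,k} are cosets of cosets of formal sums of trees, so the work is done
  with representatives: a metric becomes a form on the free nonassociative algebra whose radical is
  exactly the preimage of C^k, and vanishing in n_{m,k} becomes membership in that preimage. Two
  opposite tools decide membership. It is refuted by word coefficients, since commutators satisfy
  all Lie relations and the image of C^r contains no word of length at most r. It is established by
  rewriting trees with antisymmetry and Jacobi, which for the two small algebras leaves a short list
  of basis trees.

  The exceptional pairs are those in which C^{k-1} is too small for the count: its dimension is 3, 2
  and 1 for (3,2), (2,3) and (2,2), never more than m. For (2,2) the obstruction comes instead from
  comparing invariance with symmetry, and there characteristic 0 enters through 2 being
  nonzero.\<close>

text \<open>The concatenation product of noncommutative power series: a sum over all splittings of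
  the word into prefix and suffix. The recursion asks whether the prefix is empty or takes the first
  letter. Arbitrary functions on words are allowed, so no finiteness condition has to be carried
  along.\<close>

fun conv :: "('x list \<Rightarrow> 'k::comm_ring_1) \<Rightarrow> ('x list \<Rightarrow> 'k) \<Rightarrow> 'x list \<Rightarrow> 'k" where
  "conv f g [] = f [] * g []"
| "conv f g (x # w) = f [] * g (x # w) + conv (\<lambda>v. f (x # v)) g w"

lemma conv_add_left: "conv (\<lambda>v. f v + f' v) g w = conv f g w + conv f' g w"
  by (induction w arbitrary: f f') (auto simp: algebra_simps)

lemma conv_add_right: "conv f (\<lambda>v. g v + g' v) w = conv f g w + conv f g' w"
  by (induction w arbitrary: f) (auto simp: algebra_simps)

lemma conv_scale_left: "conv (\<lambda>v. c * f v) g w = c * conv f g w"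
  by (induction w arbitrary: f) (auto simp: algebra_simps)

lemma conv_scale_right: "conv f (\<lambda>v. c * g v) w = c * conv f g w"
  by (induction w arbitrary: f) (auto simp: algebra_simps)

lemma conv_zero_left: "conv (\<lambda>v. 0) g w = 0"
  by (induction w) auto

lemma conv_zero_right: "conv f (\<lambda>v. 0) w = 0"
  by (induction w arbitrary: f) auto

lemma conv_diff_left: "conv (\<lambda>v. f v - f' v) g w = conv f g w - conv f' g w"
  using conv_add_left[of f "\<lambda>v. (-1) * f' v" g w] by (simp only: conv_scale_left) simp

lemma conv_diff_right: "conv f (\<lambda>v. g v - g' v) w = conv f g w - conv f g' w"
  using conv_add_right[of f g "\<lambda>v. (-1) * g' v" w] by (simp only: conv_scale_right) simp

lemma conv_sum_left: "conv (\<lambda>v. \<Sum>a\<in>S. f a v) g w = (\<Sum>a\<in>S. conv (f a) g w)"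
  by (induction S rule: infinite_finite_induct) (auto simp: conv_zero_left conv_add_left)

lemma conv_sum_right: "conv f (\<lambda>v. \<Sum>a\<in>S. g a v) w = (\<Sum>a\<in>S. conv f (g a) w)"
  by (induction S rule: infinite_finite_induct) (auto simp: conv_zero_right conv_add_right)

lemma conv_assoc: "conv (conv f g) h w = conv f (conv g h) w"
proof (induction w arbitrary: f)
  case (Cons x w)
  have "conv (\<lambda>v. conv f g (x # v)) h w
      = f [] * conv (\<lambda>v. g (x # v)) h w + conv (conv (\<lambda>v. f (x # v)) g) h w"
    by (simp add: conv_add_left conv_scale_left)
  then show ?case
    by (simp add: Cons algebra_simps)
qed simp

lemma conv_singleton_left:
  "conv (\<lambda>w. if w = [i] then 1 else 0) g w = (case w of [] \<Rightarrow> 0 | x # v \<Rightarrow> if x = i then g v else 0)"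
proof (cases w)
  case (Cons x v)
  have "conv (\<lambda>w. if w = [] then 1 else 0) g v = g v"
    by (cases v) (auto simp: conv_zero_left)
  then show ?thesis
    using Cons by (auto simp: conv_zero_left)
qed simp

lemma conv_singleton_right:
  "conv f (\<lambda>w. if w = [i] then 1 else 0) w
    = (if w = [] then 0 else if last w = i then f (butlast w) else 0)"
proof (induction w arbitrary: f)
  case (Cons x w)
  then show ?case by (cases w) auto
qed simp

text \<open>Orders of power series add: a prefix longer than \<open>a\<close> and a suffix longer
  than \<open>b\<close> make a word of length at least \<open>a + b + 2\<close>.\<close>

lemma conv_eq_0_if_short:
  assumes "\<And>v. length v \<le> a \<Longrightarrow> f v = 0" "\<And>v. length v \<le> b \<Longrightarrow> g v = 0" "length w \<le> a + b + 1"
  shows "conv f g w = 0"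
  using assms
proof (induction w arbitrary: f a)
  case (Cons x w)
  show ?case
  proof (cases a)
    case 0
    have "conv (\<lambda>v. f (x # v)) g w = 0"
    proof -
      \<comment> \<open>Shifting the left factor by a letter destroys its vanishing once
        \<open>a\<close> is 0, so \<open>h\<close> is arbitrary here; every suffix of
        \<open>v\<close> is short enough for \<open>g\<close> to vanish on it.\<close>
      have "conv h g v = 0" if "length v \<le> b" for h v
        using that
      proof (induction v arbitrary: h)
        case (Cons y v)
        then show ?case using assms(2) by simp
      qed (use assms(2) in simp)
      then show ?thesis using Cons.prems 0 by simp
    qed
    then show ?thesis using Cons.prems by simp
  next
    case (Suc a')
    have "conv (\<lambda>v. f (x # v)) g w = 0"
      by (rule Cons.IH[of a']) (use Cons.prems Suc in auto)
    then show ?thesis using Cons.prems by simp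
  qed
qed simp

primrec tree_coeff :: "'x magma \<Rightarrow> 'x list \<Rightarrow> 'k::field" where
  "tree_coeff (Gen i) = (\<lambda>w. if w = [i] then 1 else 0)"
| "tree_coeff (Prod s t)
    = (\<lambda>w. conv (tree_coeff s) (tree_coeff t) w - conv (tree_coeff t) (tree_coeff s) w)"

text \<open>The coefficient of the word \<open>w\<close> in the image of \<open>f\<close> in the free associative algebra,
  its bracket being the commutator.\<close>

definition word_coeff :: "('x magma \<Rightarrow>\<^sub>0 'k::field) \<Rightarrow> 'x list \<Rightarrow> 'k" where
  "word_coeff f w = (\<Sum>t\<in>Poly_Mapping.keys f. Poly_Mapping.lookup f t * tree_coeff t w)"

lemma word_coeff_superset:
  assumes "finite S" "Poly_Mapping.keys f \<subseteq> S"
  shows "word_coeff f w = (\<Sum>t\<in>S. Poly_Mapping.lookup f t * tree_coeff t w)"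
  unfolding word_coeff_def
  by (rule sum.mono_neutral_left) (use assms in \<open>auto simp: in_keys_iff\<close>)

lemma word_coeff_zero [simp]: "word_coeff 0 w = 0"
  by (simp add: word_coeff_def)

lemma word_coeff_add [simp]: "word_coeff (f + g) w = word_coeff f w + word_coeff g w"
  using Poly_Mapping.keys_add[of f g]
  by (simp add: word_coeff_superset[of "Poly_Mapping.keys f \<union> Poly_Mapping.keys g"]
      lookup_add distrib_right sum.distrib)

lemma word_coeff_sum: "word_coeff (\<Sum>a\<in>S. f a) w = (\<Sum>a\<in>S. word_coeff (f a) w)"
  by (induction S rule: infinite_finite_induct) auto

lemma word_coeff_smul [simp]: "word_coeff (Poly_Mapping.map ((*) c) f) w = c * word_coeff f w"
  using keys_scale[of c f]
  by (simp add: word_coeff_superset[of "Poly_Mapping.keys f"] lookup_scale sum_distrib_left mult.assoc)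

lemma word_coeff_single [simp]: "word_coeff (Poly_Mapping.single t c) w = c * tree_coeff t w"
  by (simp add: word_coeff_superset[of "{t}"])

lemma word_coeff_bracket:
  fixes f g :: "'x magma \<Rightarrow>\<^sub>0 'k::field"
  shows "word_coeff (magma_mult f g) w
    = conv (word_coeff f) (word_coeff g) w - conv (word_coeff g) (word_coeff f) w"
proof -
  let ?K = "Poly_Mapping.keys" and ?l = "Poly_Mapping.lookup"
  have wc: "word_coeff h = (\<lambda>w. \<Sum>t\<in>?K h. ?l h t * tree_coeff t w)" for h :: "'x magma \<Rightarrow>\<^sub>0 'k"
    by (simp add: word_coeff_def fun_eq_iff)
  have cv: "conv (word_coeff h) (word_coeff h') w
      = (\<Sum>s\<in>?K h. \<Sum>t\<in>?K h'. ?l h s * ?l h' t * conv (tree_coeff s) (tree_coeff t) w)"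
    for h h' :: "'x magma \<Rightarrow>\<^sub>0 'k"
    unfolding wc conv_sum_left conv_sum_right conv_scale_left conv_scale_right
    by (simp add: sum_distrib_left mult.assoc)
  have "word_coeff (magma_mult f g) w
      = (\<Sum>s\<in>?K f. \<Sum>t\<in>?K g. ?l f s * ?l g t * tree_coeff (Prod s t) w)"
    unfolding magma_mult_def word_coeff_sum word_coeff_single ..
  also have "\<dots> = conv (word_coeff f) (word_coeff g) w
      - (\<Sum>s\<in>?K f. \<Sum>t\<in>?K g. ?l f s * ?l g t * conv (tree_coeff t) (tree_coeff s) w)"
    by (simp add: cv sum_subtractf right_diff_distrib)
  also have "(\<Sum>s\<in>?K f. \<Sum>t\<in>?K g. ?l f s * ?l g t * conv (tree_coeff t) (tree_coeff s) w)
      = conv (word_coeff g) (word_coeff f) w"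
    unfolding cv by (subst sum.swap) (simp add: mult.commute mult.left_commute)
  finally show ?thesis .
qed

lemma word_coeff_bracket_fun:
  "word_coeff (magma_mult f g)
    = (\<lambda>w. conv (word_coeff f) (word_coeff g) w - conv (word_coeff g) (word_coeff f) w)"
  by (simp add: fun_eq_iff word_coeff_bracket)

text \<open>Without constant terms, bracketing with any element raises the minimal word length by at
  least one.\<close>

lemma tree_coeff_Nil [simp]: "tree_coeff t [] = 0"
  by (induction t) auto

lemma word_coeff_Nil [simp]: "word_coeff f [] = 0"
  by (simp add: word_coeff_def)

text \<open>Associativity of \<open>conv\<close> is what makes this work: the twelve triple products
  cancel in pairs.\<close>

lemma word_coeff_jacobi:
  "word_coeff (magma_mult f (magma_mult g h) + (magma_mult g (magma_mult h f)
     + magma_mult h (magma_mult f g))) w = 0"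
  by (simp add: word_coeff_bracket_fun conv_diff_left conv_diff_right flip: conv_assoc)


section \<open>The projection onto the free nilpotent Lie algebra\<close>

definition nilproj ::
  "nat \<Rightarrow> nat \<Rightarrow> (nat magma \<Rightarrow>\<^sub>0 'k::field) \<Rightarrow> (nat magma \<Rightarrow>\<^sub>0 'k) set set" where
  "nilproj m k f = coset (free_lie {..<m}) (central_descending (free_lie {..<m}) k)
     (coset (free_nonassoc {..<m})
        (ideal_generated (free_nonassoc {..<m}) (lie_relations (free_nonassoc {..<m}))) f)"

definition lieproj :: "'x set \<Rightarrow> ('x magma \<Rightarrow>\<^sub>0 'k::field) \<Rightarrow> ('x magma \<Rightarrow>\<^sub>0 'k) set" where
  "lieproj X f = coset (free_nonassoc X)
     (ideal_generated (free_nonassoc X) (lie_relations (free_nonassoc X))) f"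

lemma free_nonassoc_simps [simp]:
  "zero (free_nonassoc X) = 0"
  "add (free_nonassoc X) = (+)"
  "smul (free_nonassoc X) = (\<lambda>c. Poly_Mapping.map ((*) c))"
  "bracket (free_nonassoc X) = magma_mult"
  by (simp_all add: free_nonassoc_def)

lemma alg_with_ideal_free_nonassoc:
  "alg_with_ideal (free_nonassoc X :: ('k::field, _) alg)
     (ideal_generated (free_nonassoc X) (lie_relations (free_nonassoc X)))"
  by (intro alg_with_ideal.intro alg_with_ideal_axioms.intro nonassoc_algebra_free_nonassoc
      nonassoc_algebra.ideal_generated_ideal lie_relations_carrier)

lemma alg_with_ideal_free_lie:
  "alg_with_ideal (free_lie X :: ('k::field, _) alg) (central_descending (free_lie X) k)"
  using lie_algebra_free_lie[of X, where 'k = 'k]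
  by (intro alg_with_ideal.intro alg_with_ideal_axioms.intro lie_algebra.cd_ideal)
     (auto simp: lie_algebra_def)

lemma lieproj_simps:
  assumes "f \<in> carrier (free_nonassoc X)"
  shows "lieproj X f \<in> carrier (free_lie X :: ('k::field, _) alg)"
    and "smul (free_lie X) c (lieproj X f) = lieproj X (Poly_Mapping.map ((*) c) f)"
    and "g \<in> carrier (free_nonassoc X) \<Longrightarrow>
          add (free_lie X) (lieproj X f) (lieproj X g) = lieproj X (f + g)"
    and "g \<in> carrier (free_nonassoc X) \<Longrightarrow>
          bracket (free_lie X) (lieproj X f) (lieproj X g) = lieproj X (magma_mult f g)"
  using assms alg_with_ideal.q[OF alg_with_ideal_free_nonassoc[of X, where 'k = 'k]]
  by (auto simp: free_lie_def lieproj_def)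

lemma carrier_free_lie:
  "carrier (free_lie X :: ('k::field, _) alg) = lieproj X ` carrier (free_nonassoc X)"
  using alg_with_ideal.q(1)[OF alg_with_ideal_free_nonassoc[of X, where 'k = 'k]]
  by (auto simp: free_lie_def lieproj_def)

lemma zero_free_lie: "zero (free_lie X :: ('k::field, _) alg) = lieproj X 0"
  using alg_with_ideal.q(2)[OF alg_with_ideal_free_nonassoc[of X, where 'k = 'k]]
  by (auto simp: free_lie_def lieproj_def)

lemma nilproj_lieproj:
  "nilproj m k f = coset (free_lie {..<m}) (central_descending (free_lie {..<m}) k) (lieproj {..<m} f)"
  by (simp add: nilproj_def lieproj_def)

lemma nilproj_simps:
  assumes "f \<in> carrier (free_nonassoc {..<m})"
  shows "nilproj m k f \<in> carrier (free_nilpotent m k :: ('k::field, _) alg)"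
    and "smul (free_nilpotent m k) c (nilproj m k f) = nilproj m k (Poly_Mapping.map ((*) c) f)"
    and "g \<in> carrier (free_nonassoc {..<m}) \<Longrightarrow>
          add (free_nilpotent m k) (nilproj m k f) (nilproj m k g) = nilproj m k (f + g)"
    and "g \<in> carrier (free_nonassoc {..<m}) \<Longrightarrow>
          bracket (free_nilpotent m k) (nilproj m k f) (nilproj m k g) = nilproj m k (magma_mult f g)"
  using assms alg_with_ideal.q[OF alg_with_ideal_free_lie[of "{..<m}" k, where 'k = 'k]]
  by (auto simp: free_nilpotent_def nilproj_lieproj lieproj_simps)

lemma carrier_free_nilpotent:
  "carrier (free_nilpotent m k :: ('k::field, _) alg) = nilproj m k ` carrier (free_nonassoc {..<m})"
  using alg_with_ideal.q(1)[OF alg_with_ideal_free_lie[of "{..<m}" k, where 'k = 'k]]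
  by (auto simp: free_nilpotent_def nilproj_lieproj carrier_free_lie)

lemma zero_free_nilpotent: "zero (free_nilpotent m k :: ('k::field, _) alg) = nilproj m k 0"
  using alg_with_ideal.q(2)[OF alg_with_ideal_free_lie[of "{..<m}" k, where 'k = 'k]]
  by (auto simp: free_nilpotent_def nilproj_lieproj zero_free_lie)

text \<open>Congruence modulo C^r is expressed by this single subspace of the free nonassociative
  algebra. It contains the Lie relations, so it absorbs both quotient steps at once.\<close>

definition cd_preimage :: "nat \<Rightarrow> nat \<Rightarrow> (nat magma \<Rightarrow>\<^sub>0 'k::field) set" where
  "cd_preimage m r = {f \<in> carrier (free_nonassoc {..<m}).
     lieproj {..<m} f \<in> central_descending (free_lie {..<m}) r}"

lemma nilproj_eq_zero:
  assumes "f \<in> carrier (free_nonassoc {..<m})"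
  shows "nilproj m k f = zero (free_nilpotent m k :: ('k::field, _) alg) \<longleftrightarrow> f \<in> cd_preimage m k"
  using assms alg_with_ideal.coset_eq_zero[OF alg_with_ideal_free_lie[of "{..<m}" k, where 'k = 'k]]
  by (simp add: cd_preimage_def nilproj_lieproj zero_free_nilpotent lieproj_simps(1)
      zero_free_lie[symmetric] alg_with_ideal.coset_zero[OF alg_with_ideal_free_lie])

lemma carrier_free_nonassoc_closed:
  shows "0 \<in> carrier (free_nonassoc X :: ('k::field, _) alg)"
    and "f \<in> carrier (free_nonassoc X :: ('k::field, _) alg) \<Longrightarrow> g \<in> carrier (free_nonassoc X) \<Longrightarrow>
      f + g \<in> carrier (free_nonassoc X)"
    and "f \<in> carrier (free_nonassoc X) \<Longrightarrow>
      Poly_Mapping.map ((*) (c::'k::field)) f \<in> carrier (free_nonassoc X)"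
    and "f \<in> carrier (free_nonassoc X :: ('k::field, _) alg) \<Longrightarrow> g \<in> carrier (free_nonassoc X) \<Longrightarrow>
      magma_mult f g \<in> carrier (free_nonassoc X)"
  using nonassoc_algebra.zero_closed[OF nonassoc_algebra_free_nonassoc[of X, where 'k = 'k]]
    nonassoc_algebra.add_closed[OF nonassoc_algebra_free_nonassoc[of X, where 'k = 'k]]
    nonassoc_algebra.smul_closed[OF nonassoc_algebra_free_nonassoc[of X, where 'k = 'k]]
    nonassoc_algebra.bracket_closed[OF nonassoc_algebra_free_nonassoc[of X, where 'k = 'k]]
  by auto

lemma single_in_carrier:
  "leaves t \<subseteq> X \<Longrightarrow> Poly_Mapping.single t c \<in> carrier (free_nonassoc X :: ('k::field, _) alg)"
  by (auto simp: free_nonassoc_def)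

lemma cd_preimage_carrier: "f \<in> cd_preimage m r \<Longrightarrow> f \<in> carrier (free_nonassoc {..<m})"
  by (simp add: cd_preimage_def)

lemma lin_subspace_central_descending:
  "lin_subspace (free_lie X :: ('k::field, _) alg) (central_descending (free_lie X) r)"
  using lie_algebra.cd_ideal[OF lie_algebra_free_lie] by (auto simp: alg_ideal_def)

lemma cd_preimage_zero: "0 \<in> cd_preimage m r"
  using lin_subspace_central_descending[of "{..<m}" r]
  by (auto simp: cd_preimage_def carrier_free_nonassoc_closed lin_subspace_def zero_free_lie)

lemma cd_preimage_add: "f \<in> cd_preimage m r \<Longrightarrow> g \<in> cd_preimage m r \<Longrightarrow> f + g \<in> cd_preimage m r"
  using lin_subspace_central_descending[of "{..<m}" r]
  by (auto simp: cd_preimage_def carrier_free_nonassoc_closed lin_subspace_def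
      simp flip: lieproj_simps)

lemma cd_preimage_smul: "f \<in> cd_preimage m r \<Longrightarrow> Poly_Mapping.map ((*) c) f \<in> cd_preimage m r"
  using lin_subspace_central_descending[of "{..<m}" r]
  by (auto simp: cd_preimage_def carrier_free_nonassoc_closed lin_subspace_def
      simp flip: lieproj_simps)

lemma cd_preimage_sum: "(\<And>a. a \<in> S \<Longrightarrow> f a \<in> cd_preimage m r) \<Longrightarrow> (\<Sum>a\<in>S. f a) \<in> cd_preimage m r"
  by (induction S rule: infinite_finite_induct) (auto simp: cd_preimage_zero cd_preimage_add)

lemma cd_preimage_0: "cd_preimage m 0 = carrier (free_nonassoc {..<m})"
  by (auto simp: cd_preimage_def lieproj_simps)

lemma bracket_in_cd_preimage:
  assumes "f \<in> carrier (free_nonassoc {..<m})" "g \<in> cd_preimage m r"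
  shows "magma_mult f g \<in> cd_preimage m (Suc r)"
proof -
  have "bracket (free_lie {..<m}) (lieproj {..<m} f) (lieproj {..<m} g)
      \<in> central_descending (free_lie {..<m}) (Suc r)"
    using assms lieproj_simps(1)[of f "{..<m}"]
    unfolding central_descending.simps lin_span_def cd_preimage_def by blast
  then show ?thesis
    using assms by (simp add: cd_preimage_def carrier_free_nonassoc_closed lieproj_simps
        del: central_descending.simps)
qed

lemma relations_in_cd_preimage:
  assumes "r \<in> lie_relations (free_nonassoc {..<m})"
  shows "r \<in> cd_preimage m k"
proof -
  interpret J: alg_with_ideal "free_nonassoc {..<m} :: ('a, nat magma \<Rightarrow>\<^sub>0 'a) alg"
    "ideal_generated (free_nonassoc {..<m}) (lie_relations (free_nonassoc {..<m}))"
    by (rule alg_with_ideal_free_nonassoc)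
  have "r \<in> ideal_generated (free_nonassoc {..<m}) (lie_relations (free_nonassoc {..<m}))"
    using assms by (auto simp: ideal_generated_def)
  then have "lieproj {..<m} r = zero (free_lie {..<m})" "r \<in> carrier (free_nonassoc {..<m})"
    using J.coset_eq_zero J.Isub J.coset_zero by (auto simp: zero_free_lie lieproj_def)
  then show ?thesis
    using lin_subspace_central_descending[of "{..<m}" k, where 'k = 'a]
    by (simp add: cd_preimage_def lin_subspace_def)
qed

lemma square_in_cd_preimage:
  assumes "f \<in> carrier (free_nonassoc {..<m})"
  shows "magma_mult f f \<in> cd_preimage m k"
proof (rule relations_in_cd_preimage)
  show "magma_mult f f \<in> lie_relations (free_nonassoc {..<m})"
    using assms by (auto simp: lie_relations_def)
qed

lemma jacobi_in_cd_preimage: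
  assumes "f \<in> carrier (free_nonassoc {..<m})" "g \<in> carrier (free_nonassoc {..<m})"
    "h \<in> carrier (free_nonassoc {..<m})"
  shows "magma_mult f (magma_mult g h) + (magma_mult g (magma_mult h f)
     + magma_mult h (magma_mult f g)) \<in> cd_preimage m k"
proof (rule relations_in_cd_preimage)
  show "magma_mult f (magma_mult g h) + (magma_mult g (magma_mult h f)
     + magma_mult h (magma_mult f g)) \<in> lie_relations (free_nonassoc {..<m})"
    using assms unfolding lie_relations_def jacobiator_def by auto
qed

section \<open>Word coefficients on the free Lie algebra and its central descending series\<close>

text \<open>The elements with zero image in the free associative algebra form an ideal that contains
  all squares and Jacobi expressions, hence the ideal they generate. Word coefficients thus depend
  on the Lie class alone.\<close>

lemma word_coeff_relations:
  "f \<in> ideal_generated (free_nonassoc X) (lie_relations (free_nonassoc X)) \<Longrightarrow> word_coeff f w = 0"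
proof -
  assume f: "f \<in> ideal_generated (free_nonassoc X) (lie_relations (free_nonassoc X))"
  let ?I = "{f \<in> carrier (free_nonassoc X). word_coeff f = (\<lambda>w. 0)}"
  have "alg_ideal (free_nonassoc X) ?I"
    by (auto simp: alg_ideal_def lin_subspace_def carrier_free_nonassoc_closed word_coeff_bracket_fun
        conv_zero_left conv_zero_right)
  moreover have "lie_relations (free_nonassoc X) \<subseteq> ?I"
    unfolding lie_relations_def jacobiator_def
    by (auto simp: carrier_free_nonassoc_closed word_coeff_bracket_fun simp del: word_coeff_add)
       (use word_coeff_jacobi in fastforce)
  ultimately have "f \<in> ?I"
    using f unfolding ideal_generated_def by blast
  then show ?thesis by simp
qed

lemma word_coeff_lieproj_cong:
  assumes "lieproj X f = lieproj X g" "f \<in> carrier (free_nonassoc X)" "g \<in> carrier (free_nonassoc X)"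
  shows "word_coeff f w = word_coeff g w"
proof -
  interpret J: alg_with_ideal "free_nonassoc X :: ('b, 'a magma \<Rightarrow>\<^sub>0 'b) alg"
    "ideal_generated (free_nonassoc X) (lie_relations (free_nonassoc X))"
    by (rule alg_with_ideal_free_nonassoc)
  have "f \<in> lieproj X g"
    using assms J.coset_self by (metis lieproj_def)
  then obtain i where "i \<in> ideal_generated (free_nonassoc X) (lie_relations (free_nonassoc X))" "f = g + i"
    by (auto simp: lieproj_def coset_def)
  then show ?thesis by (simp add: word_coeff_relations)
qed

text \<open>C^0 has no empty word, and each further bracket lengthens the shortest word by
  one.\<close>

lemma word_coeff_cd_preimage:
  assumes "f \<in> cd_preimage m r" "length w \<le> r"
  shows "word_coeff f w = 0"
proof -
  let ?V = "\<lambda>r. {f \<in> carrier (free_nonassoc {..<m}). \<forall>w. length w \<le> r \<longrightarrow> word_coeff f w = (0::'a)}"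
  \<comment> \<open>The induction claims one good representative per class, which suits a span in
    the quotient; independence of the representative then extends the vanishing to \<open>f\<close>
    itself.\<close>
  have "central_descending (free_lie {..<m}) r \<subseteq> lieproj {..<m} ` ?V r"
  proof (induction r)
    case 0
    then show ?case by (auto simp: carrier_free_lie)
  next
    case (Suc r)
    let ?W = "lieproj {..<m} ` ?V (Suc r)"
    have "lin_subspace (free_lie {..<m}) ?W"
      unfolding lin_subspace_def
    proof (intro conjI ballI allI)
      show "?W \<subseteq> carrier (free_lie {..<m})"
        by (auto simp: lieproj_simps)
      show "zero (free_lie {..<m}) \<in> ?W"
        unfolding zero_free_lie by (rule imageI) (simp add: carrier_free_nonassoc_closed)
    next
      fix x y assume "x \<in> ?W" "y \<in> ?W"
      then show "add (free_lie {..<m}) x y \<in> ?W"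
        by (auto simp: lieproj_simps carrier_free_nonassoc_closed intro!: imageI)
    next
      fix c x assume "x \<in> ?W"
      then show "smul (free_lie {..<m}) c x \<in> ?W"
        by (auto simp: lieproj_simps carrier_free_nonassoc_closed intro!: imageI)
    qed
    moreover have "bracket (free_lie {..<m}) x y \<in> ?W"
      if xy: "x \<in> carrier (free_lie {..<m})" "y \<in> central_descending (free_lie {..<m}) r" for x y
    proof -
      obtain f where f: "f \<in> carrier (free_nonassoc {..<m})" "x = lieproj {..<m} f"
        using xy by (auto simp: carrier_free_lie)
      obtain g where g: "g \<in> ?V r" "y = lieproj {..<m} g"
        using xy Suc by auto
      have "word_coeff (magma_mult f g) w = 0" if "length w \<le> Suc r" for w
        unfolding word_coeff_bracket
        using conv_eq_0_if_short[of 0 "word_coeff f" r "word_coeff g" w]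
          conv_eq_0_if_short[of r "word_coeff g" 0 "word_coeff f" w] g that
        by auto
      then show ?thesis
        using f g by (auto simp: lieproj_simps carrier_free_nonassoc_closed intro!: imageI)
    qed
    ultimately show ?case
      unfolding central_descending.simps lin_span_def by blast
  qed
  then obtain g where "g \<in> ?V r" "lieproj {..<m} f = lieproj {..<m} g"
    using assms(1) by (auto simp: cd_preimage_def)
  then show ?thesis
    using word_coeff_lieproj_cong[of "{..<m}" f g w] assms by (auto simp: cd_preimage_def)
qed


section \<open>Metrics as forms on the free nonassociative algebra\<close>

text \<open>Nondegeneracy turns into an equivalence: one direction says that the radical is no
  larger than the kernel of the projection, the other that the form descends to the
  quotient.\<close>

definition metric_pullback ::
  "nat \<Rightarrow> nat \<Rightarrow> ((nat magma \<Rightarrow>\<^sub>0 'k::field) \<Rightarrow> (nat magma \<Rightarrow>\<^sub>0 'k) \<Rightarrow> 'k) \<Rightarrow> bool" where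
  "metric_pullback m k b \<longleftrightarrow> (let F = carrier (free_nonassoc {..<m}) in
     (\<forall>f\<in>F. \<forall>g\<in>F. \<forall>h\<in>F. b (f + g) h = b f h + b g h) \<and>
     (\<forall>c. \<forall>f\<in>F. \<forall>g\<in>F. b (Poly_Mapping.map ((*) c) f) g = c * b f g) \<and>
     (\<forall>f\<in>F. \<forall>g\<in>F. b f g = b g f) \<and>
     (\<forall>f\<in>F. (\<forall>g\<in>F. b f g = 0) \<longleftrightarrow> f \<in> cd_preimage m k) \<and>
     (\<forall>f\<in>F. \<forall>g\<in>F. \<forall>h\<in>F. b (magma_mult f g) h + b g (magma_mult f h) = 0))"

lemma metric_pullbackD:
  assumes "metric_pullback m k b" "f \<in> carrier (free_nonassoc {..<m})"
    "g \<in> carrier (free_nonassoc {..<m})"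
  shows "b (Poly_Mapping.map ((*) c) f) g = c * b f g"
    and "b f g = b g f"
    and "h \<in> carrier (free_nonassoc {..<m}) \<Longrightarrow> b (f + g) h = b f h + b g h"
    and "h \<in> carrier (free_nonassoc {..<m}) \<Longrightarrow> b (magma_mult f g) h = - b g (magma_mult f h)"
    and "f \<in> cd_preimage m k \<Longrightarrow> b f g = 0"
    and "(\<And>h. h \<in> carrier (free_nonassoc {..<m}) \<Longrightarrow> b f h = 0) \<Longrightarrow> f \<in> cd_preimage m k"
  using assms by (auto simp: metric_pullback_def Let_def add_eq_0_iff2)

lemma admits_ad_invariant_metric_free_nilpotent:
  "admits_ad_invariant_metric (free_nilpotent m k :: ('k::field, _) alg)
    \<longleftrightarrow> (\<exists>b :: (nat magma \<Rightarrow>\<^sub>0 'k) \<Rightarrow> _ \<Rightarrow> 'k. metric_pullback m k b)"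
proof
  let ?F = "carrier (free_nonassoc {..<m} :: ('k, nat magma \<Rightarrow>\<^sub>0 'k) alg)"
  let ?Q = "free_nilpotent m k :: ('k, (nat magma \<Rightarrow>\<^sub>0 'k) set set) alg"
  assume "admits_ad_invariant_metric ?Q"
  then obtain B where B: "ad_invariant_metric ?Q B"
    by (auto simp: admits_ad_invariant_metric_def)
  then have Bsmul: "\<forall>c. \<forall>X\<in>carrier ?Q. \<forall>Y\<in>carrier ?Q. B (smul ?Q c X) Y = c * B X Y"
    unfolding ad_invariant_metric_def by (elim conjE)
  define b where "b f g = B (nilproj m k f) (nilproj m k g)" for f g
  have "(\<forall>g\<in>?F. b f g = 0) \<longleftrightarrow> f \<in> cd_preimage m k" if f: "f \<in> ?F" for f
  proof
    assume "\<forall>g\<in>?F. b f g = 0"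
    then have "nilproj m k f = zero ?Q"
      using B f unfolding ad_invariant_metric_def b_def by (auto simp: carrier_free_nilpotent)
    then show "f \<in> cd_preimage m k"
      using f by (simp add: nilproj_eq_zero)
  next
    assume "f \<in> cd_preimage m k"
    then have "nilproj m k f = nilproj m k 0"
      using nilproj_eq_zero[OF f, of k] zero_free_nilpotent[of m k, where 'k = 'k] by simp
    \<comment> \<open>Writing the zero class as 0 times itself lets homogeneity of \<open>B\<close>
      give the value 0.\<close>
    also have "\<dots> = smul ?Q 0 (nilproj m k f)"
    proof -
      have "Poly_Mapping.map ((*) 0) f = 0"
        by (intro poly_mapping_eqI) (simp add: lookup_scale)
      then show ?thesis using nilproj_simps(2)[OF f, of k 0] by simp
    qed
    finally have eq: "nilproj m k f = smul ?Q 0 (nilproj m k f)" .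
    have "b f g = 0" if g: "g \<in> ?F" for g
    proof -
      have "b f g = B (smul ?Q 0 (nilproj m k f)) (nilproj m k g)"
        unfolding b_def by (rule arg_cong2[OF eq refl])
      also have "\<dots> = 0 * B (nilproj m k f) (nilproj m k g)"
        by (rule Bsmul[rule_format, OF nilproj_simps(1)[OF f] nilproj_simps(1)[OF g]])
      finally show ?thesis by simp
    qed
    then show "\<forall>g\<in>?F. b f g = 0" by simp
  qed
  then have "metric_pullback m k b"
    using B unfolding metric_pullback_def ad_invariant_metric_def Let_def b_def
    by (simp add: carrier_free_nilpotent nilproj_simps)
  then show "\<exists>b :: (nat magma \<Rightarrow>\<^sub>0 'k) \<Rightarrow> _ \<Rightarrow> 'k. metric_pullback m k b" by blast
next
  let ?F = "carrier (free_nonassoc {..<m} :: ('k, nat magma \<Rightarrow>\<^sub>0 'k) alg)"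
  let ?Q = "free_nilpotent m k :: ('k, (nat magma \<Rightarrow>\<^sub>0 'k) set set) alg"
  interpret Q: lie_algebra ?Q by (rule lie_algebra_free_nilpotent)
  assume "\<exists>b :: (nat magma \<Rightarrow>\<^sub>0 'k) \<Rightarrow> _ \<Rightarrow> 'k. metric_pullback m k b"
  then obtain b :: "(nat magma \<Rightarrow>\<^sub>0 'k) \<Rightarrow> _ \<Rightarrow> 'k" where b: "metric_pullback m k b" ..
  define rep where "rep X = (SOME f. f \<in> ?F \<and> nilproj m k f = X)" for X
  have rep: "rep (nilproj m k f) \<in> ?F" "nilproj m k (rep (nilproj m k f)) = nilproj m k f"
    if "f \<in> ?F" for f
    using someI[of "\<lambda>g. g \<in> ?F \<and> nilproj m k g = nilproj m k f" f] that by (auto simp: rep_def)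
  \<comment> \<open>The difference of two representatives of one class lies in the radical, so the
    arbitrary choice made by \<open>rep\<close> is harmless.\<close>
  have cong: "b f g = b f' g"
    if "nilproj m k f = nilproj m k f'" "f \<in> ?F" "f' \<in> ?F" "g \<in> ?F" for f f' g
  proof -
    have F: "Poly_Mapping.map ((*) (-1)) f' \<in> ?F" "f + Poly_Mapping.map ((*) (-1)) f' \<in> ?F"
      using that by (auto intro!: carrier_free_nonassoc_closed)
    have "nilproj m k (f + Poly_Mapping.map ((*) (-1)) f')
        = add ?Q (nilproj m k f) (smul ?Q (-1) (nilproj m k f))"
      using that F nilproj_simps(2)[of f' m k "-1"] nilproj_simps(3)[of f m "Poly_Mapping.map ((*) (-1)) f'" k]
      by simp
    also have "\<dots> = zero ?Q"
      using that by (intro Q.add_neg nilproj_simps(1))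
    finally have "b (f + Poly_Mapping.map ((*) (-1)) f') g = 0"
      using F that by (simp add: nilproj_eq_zero metric_pullbackD(5)[OF b])
    then show ?thesis
      using F that by (simp add: metric_pullbackD(1,3)[OF b])
  qed
  define B where "B X Y = b (rep X) (rep Y)" for X Y
  have B: "B (nilproj m k f) (nilproj m k g) = b f g" if "f \<in> ?F" "g \<in> ?F" for f g
  proof -
    have "B (nilproj m k f) (nilproj m k g) = b f (rep (nilproj m k g))"
      unfolding B_def using that rep by (intro cong) auto
    also have "\<dots> = b (rep (nilproj m k g)) f"
      using that rep by (intro metric_pullbackD(2)[OF b]) auto
    also have "\<dots> = b g f"
      using that rep by (intro cong) auto
    also have "\<dots> = b f g"
      using that by (intro metric_pullbackD(2)[OF b]) auto
    finally show ?thesis .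
  qed
  have "ad_invariant_metric ?Q B"
    unfolding ad_invariant_metric_def
  proof (intro conjI ballI allI impI)
    note simps = nilproj_simps B carrier_free_nonassoc_closed
    fix X Y Z assume "X \<in> carrier ?Q" "Y \<in> carrier ?Q"
    then obtain f g where f: "f \<in> ?F" "X = nilproj m k f" and g: "g \<in> ?F" "Y = nilproj m k g"
      by (auto simp: carrier_free_nilpotent)
    show "B (smul ?Q c X) Y = c * B X Y" for c
      using f g by (simp add: simps metric_pullbackD(1)[OF b])
    show "B X Y = B Y X"
      using f g by (simp add: simps metric_pullbackD(2)[OF b])
    assume "Z \<in> carrier ?Q"
    then obtain h where h: "h \<in> ?F" "Z = nilproj m k h"
      by (auto simp: carrier_free_nilpotent)
    show "B (add ?Q X Y) Z = B X Z + B Y Z"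
      using f g h by (simp add: simps metric_pullbackD(3)[OF b])
    show "B (bracket ?Q X Y) Z + B Y (bracket ?Q X Z) = 0"
      using f g h by (simp add: simps metric_pullbackD(4)[OF b])
  next
    fix X assume X: "X \<in> carrier ?Q" "\<forall>Y\<in>carrier ?Q. B X Y = 0"
    then obtain f where f: "f \<in> ?F" "X = nilproj m k f"
      by (auto simp: carrier_free_nilpotent)
    then have "b f h = 0" if "h \<in> ?F" for h
      using X(2) that B[OF f(1) that] nilproj_simps(1)[OF that] by simp
    then have "f \<in> cd_preimage m k"
      using metric_pullbackD(6)[OF b f(1) f(1)] by blast
    then show "X = zero ?Q"
      using f by (simp add: nilproj_eq_zero)
  qed
  then show "admits_ad_invariant_metric ?Q"
    by (auto simp: admits_ad_invariant_metric_def)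
qed

lemma magma_mult_single:
  "magma_mult (Poly_Mapping.single s c) (Poly_Mapping.single t d)
    = Poly_Mapping.single (Prod s t) (c * d :: 'k::field)"
  by (subst magma_mult_superset[of "{s}" _ "{t}"]) auto

lemma map_scale_single:
  "Poly_Mapping.map ((*) c) (Poly_Mapping.single t d) = Poly_Mapping.single t (c * d :: 'k::field)"
  by (intro poly_mapping_eqI) (simp add: lookup_scale lookup_single when_def)

lemma map_scale_add:
  "Poly_Mapping.map ((*) c) (f + g) = Poly_Mapping.map ((*) (c::'k::field)) f + Poly_Mapping.map ((*) c) g"
  by (intro poly_mapping_eqI) (simp add: lookup_scale lookup_add distrib_left)

lemma map_scale_diff:
  "Poly_Mapping.map ((*) c) (f - g) = Poly_Mapping.map ((*) (c::'k::field)) f - Poly_Mapping.map ((*) c) g"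
  by (intro poly_mapping_eqI) (simp add: lookup_scale lookup_minus right_diff_distrib)

lemma free_nonassoc_induct [consumes 1, case_names zero add smul tree]:
  fixes f :: "'x magma \<Rightarrow>\<^sub>0 'k::field"
  assumes f: "f \<in> carrier (free_nonassoc X)"
    and zero: "P 0"
    and add: "\<And>f g. f \<in> carrier (free_nonassoc X) \<Longrightarrow> g \<in> carrier (free_nonassoc X) \<Longrightarrow>
      P f \<Longrightarrow> P g \<Longrightarrow> P (f + g)"
    and smul: "\<And>c f. f \<in> carrier (free_nonassoc X) \<Longrightarrow> P f \<Longrightarrow> P (Poly_Mapping.map ((*) c) f)"
    and tree: "\<And>t. leaves t \<subseteq> X \<Longrightarrow> P (Poly_Mapping.single t 1)"
  shows "P f"
proof -
  let ?t = "\<lambda>t. Poly_Mapping.single t (Poly_Mapping.lookup f t)"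
  have P: "P (Poly_Mapping.single t c)" if "leaves t \<subseteq> X" for t c
    using smul[OF single_in_carrier tree, OF that that, of c] by (simp add: map_scale_single)
  have "finite T \<Longrightarrow> T \<subseteq> Poly_Mapping.keys f \<Longrightarrow>
      P (\<Sum>t\<in>T. ?t t) \<and> (\<Sum>t\<in>T. ?t t) \<in> carrier (free_nonassoc X)" for T
  proof (induction T rule: finite_induct)
    case empty
    then show ?case using zero by (simp add: carrier_free_nonassoc_closed)
  next
    case (insert t T)
    then have "leaves t \<subseteq> X" using f by (auto simp: free_nonassoc_def)
    then show ?case
      using insert P single_in_carrier by (auto intro!: add carrier_free_nonassoc_closed)
  qed
  from this[of "Poly_Mapping.keys f"] have "P (\<Sum>t\<in>Poly_Mapping.keys f. ?t t)"
    by simp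
  also have "(\<Sum>t\<in>Poly_Mapping.keys f. ?t t) = f"
    by (rule poly_mapping_eqI) (simp add: lookup_sum lookup_single when_def in_keys_iff)
  finally show ?thesis .
qed


section \<open>Obstructions to a metric\<close>

text \<open>Gaussian elimination on the last coordinate: a pivot \<open>s0\<close> clears it from
  the other vectors, which are still more than \<open>n\<close> many.\<close>

lemma linear_dependency:
  fixes a :: "'s \<Rightarrow> nat \<Rightarrow> 'k::field"
  assumes "finite S" "card S > n"
  shows "\<exists>c. (\<exists>s\<in>S. c s \<noteq> 0) \<and> (\<forall>i<n. (\<Sum>s\<in>S. c s * a s i) = 0)"
  using assms
proof (induction n arbitrary: S a)
  case 0
  then have "S \<noteq> {}" by auto
  then show ?case by (intro exI[of _ "\<lambda>_. 1"]) auto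
next
  case (Suc n)
  show ?case
  proof (cases "\<forall>s\<in>S. a s n = 0")
    case True
    obtain c where "\<exists>s\<in>S. c s \<noteq> 0" "\<forall>i<n. (\<Sum>s\<in>S. c s * a s i) = 0"
      using Suc.IH[of S a] Suc.prems by auto
    with True show ?thesis
      by (intro exI[of _ c]) (auto simp: less_Suc_eq)
  next
    case False
    then obtain s0 where s0: "s0 \<in> S" "a s0 n \<noteq> 0" by auto
    define S' where "S' = S - {s0}"
    have S': "finite S'" "s0 \<notin> S'" "S = insert s0 S'" "card S' > n"
      using Suc.prems s0 by (auto simp: S'_def)
    obtain c where c: "\<exists>s\<in>S'. c s \<noteq> 0"
      "\<forall>i<n. (\<Sum>s\<in>S'. c s * (a s i - a s n / a s0 n * a s0 i)) = 0"
      using Suc.IH[of S' "\<lambda>s i. a s i - a s n / a s0 n * a s0 i"] S' by blast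
    \<comment> \<open>The pivot coefficient is the one that makes the sum vanish at coordinate
      \<open>n\<close>.\<close>
    define d where "d s = (if s = s0 then - (\<Sum>s\<in>S'. c s * a s n) / a s0 n else c s)" for s
    have d: "(\<Sum>s\<in>S. d s * a s i)
        = (\<Sum>s\<in>S'. c s * a s i) - (\<Sum>s\<in>S'. c s * a s n) / a s0 n * a s0 i" for i
    proof -
      have "(\<Sum>s\<in>S'. d s * a s i) = (\<Sum>s\<in>S'. c s * a s i)"
        by (rule sum.cong) (use S' in \<open>auto simp: d_def\<close>)
      then show ?thesis
        using S' by (simp add: d_def)
    qed
    have "(\<Sum>s\<in>S. d s * a s i) = (\<Sum>s\<in>S'. c s * (a s i - a s n / a s0 n * a s0 i))" for i
      unfolding d by (simp add: right_diff_distrib sum_subtractf sum_distrib_right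
          sum_divide_distrib mult.assoc)
    then have "(\<Sum>s\<in>S. d s * a s i) = 0" if "i < n" for i
      using c that by simp
    moreover have "(\<Sum>s\<in>S. d s * a s n) = 0"
      unfolding d using s0 by simp
    moreover have "\<exists>s\<in>S. d s \<noteq> 0"
      using c S' by (auto simp: d_def)
    ultimately show ?thesis
      by (intro exI[of _ d]) (auto simp: less_Suc_eq)
  qed
qed

text \<open>Invariance moves the bracket onto \<open>z\<close>, and \<open>[f,z]\<close> lies in
  C^{r+1}, that is, in the radical.\<close>

lemma bracket_orthogonal_to_last_term:
  assumes b: "metric_pullback m (Suc r) b" and z: "z \<in> cd_preimage m r"
    and F: "f \<in> carrier (free_nonassoc {..<m})" "g \<in> carrier (free_nonassoc {..<m})"
  shows "b (magma_mult f g) z = 0"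
proof -
  have fz: "magma_mult f z \<in> cd_preimage m (Suc r)"
    using bracket_in_cd_preimage F z by blast
  have "b (magma_mult f g) z = - b g (magma_mult f z)"
    using metric_pullbackD(4)[OF b] F z cd_preimage_carrier by blast
  also have "b g (magma_mult f z) = b (magma_mult f z) g"
    using metric_pullbackD(2)[OF b] F fz cd_preimage_carrier by blast
  also have "\<dots> = 0"
    using metric_pullbackD(5)[OF b] F fz cd_preimage_carrier by blast
  finally show ?thesis by simp
qed

lemma last_term_in_radical:
  assumes b: "metric_pullback m (Suc r) b" and z: "z \<in> cd_preimage m r"
    and gens: "\<And>i. i < m \<Longrightarrow> b (Poly_Mapping.single (Gen i) 1) z = 0"
  shows "z \<in> cd_preimage m (Suc r)"
proof -
  note zF = cd_preimage_carrier[OF z]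
  have "b f z = 0" if "f \<in> carrier (free_nonassoc {..<m})" for f
    using that
  proof (induction f rule: free_nonassoc_induct)
    case zero
    show ?case
      using metric_pullbackD(5)[OF b _ zF cd_preimage_zero] by (simp add: carrier_free_nonassoc_closed)
  next
    case (add f g)
    then show ?case using metric_pullbackD(3)[OF b _ _ zF] by simp
  next
    case (smul c f)
    then show ?case using metric_pullbackD(1)[OF b _ zF] by simp
  next
    case (tree t)
    show ?case
    proof (cases t)
      case (Gen i)
      then show ?thesis using tree gens by simp
    next
      case (Prod s t')
      then show ?thesis
        using tree bracket_orthogonal_to_last_term[OF b z, of "Poly_Mapping.single s 1" "Poly_Mapping.single t' 1"]
        by (simp add: single_in_carrier magma_mult_single)
    qed
  qed
  then show ?thesis
    using metric_pullbackD(6)[OF b zF zF] metric_pullbackD(2)[OF b _ zF] zF by metis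
qed

section \<open>Right-normed brackets and their multidegrees\<close>

fun right_normed :: "'x list \<Rightarrow> 'x magma" where
  "right_normed [] = undefined"
| "right_normed [i] = Gen i"
| "right_normed (i # s) = Prod (Gen i) (right_normed s)"

declare right_normed.simps(3) [simp del]

lemma right_normed_Cons: "s \<noteq> [] \<Longrightarrow> right_normed (i # s) = Prod (Gen i) (right_normed s)"
  by (cases s) (auto simp: right_normed.simps(3))

text \<open>Since [x_i,P] = x_i P - P x_i, a word is reached from a word of P by adding the letter i
  in front or at the end.\<close>

lemma tree_coeff_right_normed_Cons:
  assumes "s \<noteq> []" "w \<noteq> []"
  shows "tree_coeff (right_normed (i # s)) w
    = (if hd w = i then tree_coeff (right_normed s) (tl w) else 0)
      - (if last w = i then tree_coeff (right_normed s) (butlast w) else 0)"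
  using assms
  by (cases w) (auto simp: right_normed_Cons conv_singleton_left conv_singleton_right)

text \<open>Brackets are multihomogeneous, so those with different letter contents share no
  word.\<close>

lemma mset_eq_if_tree_coeff_right_normed:
  "s \<noteq> [] \<Longrightarrow> tree_coeff (right_normed s) w \<noteq> (0::'k::field) \<Longrightarrow> mset w = mset s"
proof (induction s arbitrary: w rule: right_normed.induct)
  case (3 i j s)
  have w: "w \<noteq> []" using 3(3) by (metis tree_coeff_Nil)
  then consider "hd w = i" "tree_coeff (right_normed (j # s)) (tl w) \<noteq> (0::'k)"
    | "last w = i" "tree_coeff (right_normed (j # s)) (butlast w) \<noteq> (0::'k)"
    using 3(3) tree_coeff_right_normed_Cons[of "j # s" w i, where 'b = 'k]
    by (cases "tree_coeff (right_normed (j # s)) (tl w) = (0::'k)") (auto split: if_splits)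
  then show ?case
  proof cases
    case 1
    then show ?thesis
      using 3(1)[of "tl w"] w by (cases w) auto
  next
    case 2
    then have "mset (butlast w @ [last w]) = mset (i # j # s)"
      using 3(1)[of "butlast w"] by simp
    then show ?thesis using w by simp
  qed
qed (auto split: if_splits)

lemma right_normed_in_cd_preimage:
  "s \<noteq> [] \<Longrightarrow> set s \<subseteq> {..<m} \<Longrightarrow>
    Poly_Mapping.single (right_normed s) (1::'k::field) \<in> cd_preimage m (length s - 1)"
proof (induction s rule: right_normed.induct)
  case (2 i)
  then show ?case by (simp add: cd_preimage_0 single_in_carrier)
next
  case (3 i j s)
  have "magma_mult (Poly_Mapping.single (Gen i) 1) (Poly_Mapping.single (right_normed (j # s)) (1::'k))
      \<in> cd_preimage m (Suc (length (j # s) - 1))"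
    using 3 by (intro bracket_in_cd_preimage single_in_carrier) auto
  then show ?case by (simp add: magma_mult_single right_normed_Cons)
qed simp

text \<open>Pairing with the \<open>m\<close> generators maps more than \<open>m\<close> brackets
  into K^m, so a nontrivial combination is orthogonal to all generators and lies in C^{r+1}. Its
  coefficients at words of length r+1 then vanish, whereas \<open>w i\<close> exhibits a nonzero
  one.\<close>

lemma no_metric_if_many_contents:
  fixes s :: "'i \<Rightarrow> nat list"
  assumes b: "metric_pullback m (Suc r) (b :: (nat magma \<Rightarrow>\<^sub>0 'k::field) \<Rightarrow> _)"
    and I: "finite I" "card I > m" "inj_on (\<lambda>i. mset (s i)) I"
    and s: "\<And>i. i \<in> I \<Longrightarrow> length (s i) = Suc r" "\<And>i. i \<in> I \<Longrightarrow> set (s i) \<subseteq> {..<m}"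
    and nz: "\<And>i. i \<in> I \<Longrightarrow> tree_coeff (right_normed (s i)) (w i) \<noteq> (0::'k)"
  shows False
proof -
  let ?z = "\<lambda>i. Poly_Mapping.single (right_normed (s i)) (1::'k)"
  let ?e = "\<lambda>j. Poly_Mapping.single (Gen j) (1::'k)"
  obtain c where c: "\<exists>i\<in>I. c i \<noteq> 0" "\<And>j. j < m \<Longrightarrow> (\<Sum>i\<in>I. c i * b (?z i) (?e j)) = 0"
    using linear_dependency[OF I(1,2), of "\<lambda>i j. b (?z i) (?e j)"] by auto
  have z: "?z i \<in> cd_preimage m r" if "i \<in> I" for i
    using right_normed_in_cd_preimage[of "s i" m, where 'k = 'k] s[OF that]
    by (cases "s i") auto
  let ?zz = "\<lambda>T. \<Sum>i\<in>T. Poly_Mapping.map ((*) (c i)) (?z i)"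
  have zz: "?zz T \<in> cd_preimage m r" if "T \<subseteq> I" for T
    using z that by (intro cd_preimage_sum cd_preimage_smul) auto
  have lin: "b (?zz T) f = (\<Sum>i\<in>T. c i * b (?z i) f)"
    if "T \<subseteq> I" "f \<in> carrier (free_nonassoc {..<m})" for T f
    using finite_subset[OF that(1) I(1)] that(1)
  proof (induction T rule: finite_induct)
    case empty
    show ?case
      using metric_pullbackD(5)[OF b _ that(2) cd_preimage_zero]
      by (simp add: carrier_free_nonassoc_closed)
  next
    case (insert i T)
    then have F: "?zz T \<in> carrier (free_nonassoc {..<m})" "?z i \<in> carrier (free_nonassoc {..<m})"
      using cd_preimage_carrier[OF zz[of T]] cd_preimage_carrier[OF z[of i]] by blast+
    have "b (?zz (insert i T)) f = b (Poly_Mapping.map ((*) (c i)) (?z i) + ?zz T) f"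
      unfolding sum.insert[OF insert.hyps] ..
    also have "\<dots> = c i * b (?z i) f + b (?zz T) f"
      unfolding metric_pullbackD(3)[OF b carrier_free_nonassoc_closed(3)[OF F(2)] F(1) that(2)]
        metric_pullbackD(1)[OF b F(2) that(2)] ..
    also have "b (?zz T) f = (\<Sum>i\<in>T. c i * b (?z i) f)"
      using insert by blast
    finally show ?case
      unfolding sum.insert[OF insert.hyps] .
  qed
  have "?zz I \<in> cd_preimage m (Suc r)"
  proof (rule last_term_in_radical[OF b zz])
    fix j assume "j < m"
    then have "?e j \<in> carrier (free_nonassoc {..<m})"
      by (simp add: single_in_carrier)
    then show "b (?e j) (?zz I) = 0"
      using lin[OF order_refl, of "?e j"] c(2)[OF \<open>j < m\<close>]
        metric_pullbackD(2)[OF b _ cd_preimage_carrier[OF zz[OF order_refl]], of "?e j"]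
      by presburger
  qed simp
  moreover obtain i where i: "i \<in> I" "c i \<noteq> 0" using c by auto
  have w: "mset (w i) = mset (s i)"
    using s(1)[OF i(1)] by (intro mset_eq_if_tree_coeff_right_normed[OF _ nz[OF i(1)]]) auto
  then have "length (w i) = Suc r"
    using mset_eq_length s(1)[OF i(1)] by metis
  ultimately have "word_coeff (?zz I) (w i) = 0"
    by (intro word_coeff_cd_preimage[where r = "Suc r" and m = m]) simp_all
  \<comment> \<open>Distinct contents leave only the summand of \<open>i\<close> at the word
    \<open>w i\<close>.\<close>
  moreover have "word_coeff (?zz I) (w i) = (\<Sum>j\<in>I. if j = i then c i * tree_coeff (right_normed (s i)) (w i) else 0)"
    unfolding word_coeff_sum
  proof (rule sum.cong)
    fix j assume j: "j \<in> I"
    have "tree_coeff (right_normed (s j)) (w i) = (0::'k)" if "j \<noteq> i"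
    proof (rule ccontr)
      assume nz: "tree_coeff (right_normed (s j)) (w i) \<noteq> (0::'k)"
      have "mset (w i) = mset (s j)"
        using s(1)[OF j] by (intro mset_eq_if_tree_coeff_right_normed[OF _ nz]) auto
      then show False
        using w inj_onD[OF I(3) _ j i(1)] that by simp
    qed
    then show "word_coeff (Poly_Mapping.map ((*) (c j)) (?z j)) (w i)
        = (if j = i then c i * tree_coeff (right_normed (s i)) (w i) else 0)"
      by simp
  qed simp
  ultimately show False
    using i nz I(1) by simp
qed

text \<open>The word ends in \<open>j\<close>, so at each stage only the removal of a leading
  \<open>i\<close> contributes.\<close>

lemma tree_coeff_right_normed_replicate:
  "i \<noteq> j \<Longrightarrow> tree_coeff (right_normed (replicate n i @ [j])) (replicate n i @ [j]) = 1"
  by (induction n) (auto simp: tree_coeff_right_normed_Cons)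

lemma no_metric_if_many_pairs:
  assumes b: "metric_pullback m (Suc n) (b :: (nat magma \<Rightarrow>\<^sub>0 'k::field) \<Rightarrow> _)"
    and I: "finite I" "card I > m" "\<And>i j. (i, j) \<in> I \<Longrightarrow> i \<noteq> j \<and> i < m \<and> j < m"
    and inj: "inj_on (\<lambda>(i, j). mset (replicate n i @ [j])) I"
  shows False
proof -
  let ?s = "\<lambda>x. replicate n (fst x) @ [snd x]"
  show ?thesis
  proof (rule no_metric_if_many_contents[OF b I(1,2), where s = ?s and w = ?s])
  show "inj_on (\<lambda>x. mset (?s x)) I"
    using inj by (simp add: case_prod_unfold)
  fix x assume x: "x \<in> I"
  have ij: "fst x \<noteq> snd x \<and> fst x < m \<and> snd x < m"
    using I(3)[of "fst x" "snd x"] x by simp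
  show "length (?s x) = Suc n" by simp
  show "set (?s x) \<subseteq> {..<m}"
    using ij by auto
  show "tree_coeff (right_normed (?s x)) (?s x) \<noteq> (0::'k)"
    using ij by (simp add: tree_coeff_right_normed_replicate)
  qed
qed

section \<open>More than m contents in the excluded cases\<close>

text \<open>The pair (i,j) stands for ad(x_i)^n x_j. The star at 0 supplies m - 1 pairs, and two
  pairs starting at 1 bring the number to m + 1.\<close>

lemma star_with_two_edges:
  fixes m c d :: nat
  assumes "m \<ge> 3" "c < m" "d < m" "c \<noteq> 1" "d \<noteq> 1" "c \<noteq> d"
  defines "I \<equiv> insert (1, c) (insert (1, d) (Pair 0 ` {1..<m}))"
  shows "finite I" "card I > m" "\<And>i j. (i, j) \<in> I \<Longrightarrow> i \<noteq> j \<and> i < m \<and> j < m"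
proof -
  show "finite I" by (simp add: I_def)
  have "card (Pair (0::nat) ` {1..<m}) = m - 1"
    by (simp add: card_image inj_on_def)
  then show "card I > m"
    using assms(1,6) by (simp add: I_def card_insert_if image_iff)
  show "i \<noteq> j \<and> i < m \<and> j < m" if "(i, j) \<in> I" for i j
    using that assms(1-5) by (auto simp: I_def)
qed

text \<open>For length 2 the content is an unordered pair, so all pairs are taken increasing. The
  extra ones (1,2) and (1,3) require four generators; three generators have only three such
  pairs.\<close>

lemma no_metric_step2:
  assumes "m \<ge> 4"
  shows "\<not> metric_pullback m 2 (b :: (nat magma \<Rightarrow>\<^sub>0 'k::field) \<Rightarrow> _)"
proof
  assume "metric_pullback m 2 b"
  then have b: "metric_pullback m (Suc 1) b" by (simp add: numeral_2_eq_2)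
  define I :: "(nat \<times> nat) set" where "I = insert (1, 2) (insert (1, 3) (Pair 0 ` {1..<m}))"
  have "m \<ge> 3" "2 < m" "3 < m" "(2::nat) \<noteq> 1" "(3::nat) \<noteq> 1" "(2::nat) \<noteq> 3"
    using assms by simp_all
  note I = star_with_two_edges[OF this, folded I_def]
  have less: "fst x < snd x" if "x \<in> I" for x
    using that by (auto simp: I_def)
  have "inj_on (\<lambda>(i, j). mset (replicate 1 i @ [j])) I"
  proof (rule inj_onI)
    fix x y assume xy: "x \<in> I" "y \<in> I"
      "(case x of (i, j) \<Rightarrow> mset (replicate 1 i @ [j])) = (case y of (i, j) \<Rightarrow> mset (replicate 1 i @ [j]))"
    then have "mset (replicate 1 (fst x) @ [snd x]) = mset (replicate 1 (fst y) @ [snd y])"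
      by (simp only: case_prod_unfold)
    then have "set (replicate 1 (fst x) @ [snd x]) = set (replicate 1 (fst y) @ [snd y])"
      by (rule mset_eq_setD)
    then show "x = y"
      using less[OF xy(1)] less[OF xy(2)] by (auto simp: doubleton_eq_iff prod_eq_iff)
  qed
  then show False
    using no_metric_if_many_pairs[OF b I] by blast
qed

lemma no_metric_step_ge3:
  assumes "m \<ge> 3" "k \<ge> 3"
  shows "\<not> metric_pullback m k (b :: (nat magma \<Rightarrow>\<^sub>0 'k::field) \<Rightarrow> _)"
proof
  obtain n where n: "k = Suc n" "n \<ge> 2" using assms(2) by (cases k) auto
  assume "metric_pullback m k b"
  then have b: "metric_pullback m (Suc n) b" by (simp add: n)
  define I :: "(nat \<times> nat) set" where "I = insert (1, 0) (insert (1, 2) (Pair 0 ` {1..<m}))"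
  have "m \<ge> 3" "0 < m" "2 < m" "(0::nat) \<noteq> 1" "(2::nat) \<noteq> 1" "(0::nat) \<noteq> 2"
    using assms by simp_all
  note I = star_with_two_edges[OF this, folded I_def]
  have "inj_on (\<lambda>(i, j). mset (replicate n i @ [j])) I"
  proof (rule inj_onI, clarify)
    fix i j i' j' assume xy: "(i, j) \<in> I" "mset (replicate n i @ [j]) = mset (replicate n i' @ [j'])"
    \<comment> \<open>From \<open>n\<close> = 2 on, the repeated letter is recognisable from the
      content, so even (0,1) and (1,0) count separately.\<close>
    have "count (mset (replicate n i @ [j])) i \<ge> n"
      by (simp add: count_replicate_mset)
    then have "count (mset (replicate n i' @ [j'])) i \<ge> 2"
      unfolding xy(2) using n by linarith
    then have "i = i'"
      by (simp add: count_replicate_mset split: if_splits)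
    then show "i = i' \<and> j = j'" using xy(2) by simp
  qed
  then show False
    using no_metric_if_many_pairs[OF b I] by blast
qed

text \<open>Besides the two brackets ad(x_0)^{n+1} x_1 and ad(x_1)^{n+1} x_0 a third one,
  [x_1, ad(x_0)^n x_1], is available. The letter 0 occurs n+1, 1 and n times; for n = 1 the last two
  contents would coincide.\<close>

lemma no_metric_two_generators:
  assumes "k \<ge> 4"
  shows "\<not> metric_pullback 2 k (b :: (nat magma \<Rightarrow>\<^sub>0 'k::field) \<Rightarrow> _)"
proof
  obtain n where n: "k = Suc (Suc n)" "n \<ge> 2"
    using assms that[of "k - 2"] by simp
  define u where "u = replicate (Suc n) 0 @ [Suc 0]"
  define v where "v = replicate (Suc n) (Suc 0) @ [0]"
  define x where "x = Suc 0 # replicate n 0 @ [Suc 0]"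
  \<comment> \<open>The word \<open>x\<close> has coefficient 1 - (-1)^n in its own bracket, which
    vanishes for even \<open>n\<close>. Starting with 0, \<open>x'\<close> can only lose its last
    letter and gets coefficient -1.\<close>
  define x' where "x' = replicate n 0 @ [Suc 0, Suc 0]"
  assume "metric_pullback 2 k b"
  then have b: "metric_pullback 2 (Suc (Suc n)) b" by (simp add: n)
  have counts: "count (mset u) 0 = Suc n" "count (mset v) 0 = 1" "count (mset x) 0 = n"
    by (simp_all add: u_def v_def x_def count_replicate_mset)
  have "count (mset u) 0 \<noteq> count (mset v) 0" "count (mset u) 0 \<noteq> count (mset x) 0"
    "count (mset v) 0 \<noteq> count (mset x) 0"
    unfolding counts using n by simp_all
  then have ne: "mset u \<noteq> mset v" "mset u \<noteq> mset x" "mset v \<noteq> mset x"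
    by metis+
  then have neq: "u \<noteq> v" "u \<noteq> x" "v \<noteq> x" by auto
  have ne': "x' \<noteq> []" and last: "last x' = Suc 0"
    and butlast: "butlast x' = replicate n 0 @ [Suc 0]"
    by (simp_all add: x'_def butlast_append)
  have hd: "hd x' = 0"
    using n by (cases n) (simp_all add: x'_def)
  have "tree_coeff (right_normed x) x'
      = - tree_coeff (right_normed (replicate n 0 @ [Suc 0])) (replicate n 0 @ [Suc 0])"
    unfolding x_def
    using tree_coeff_right_normed_Cons[OF _ ne', of "replicate n 0 @ [Suc 0]" "Suc 0"]
    by (simp add: hd last butlast)
  then have x': "tree_coeff (right_normed x) x' = (-1::'k)"
    by (simp add: tree_coeff_right_normed_replicate)
  have uv: "tree_coeff (right_normed u) u = (1::'k)" "tree_coeff (right_normed v) v = (1::'k)"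
    unfolding u_def v_def by (rule tree_coeff_right_normed_replicate; simp)+
  have words: "length u = Suc (Suc n)" "set u \<subseteq> {..<2}" "length v = Suc (Suc n)" "set v \<subseteq> {..<2}"
    "length x = Suc (Suc n)" "set x \<subseteq> {..<2}"
    by (auto simp: u_def v_def x_def)
  show False
  proof (rule no_metric_if_many_contents[OF b, of "{u, v, x}" "\<lambda>s. s" "\<lambda>s. if s = x then x' else s"])
    show "card {u, v, x} > 2" using neq by simp
    show "inj_on mset {u, v, x}" using ne by auto
    fix s assume "s \<in> {u, v, x}"
    then consider "s = u" | "s = v" | "s = x" by blast
    then have "length s = Suc (Suc n) \<and> set s \<subseteq> {..<2} \<and>
        tree_coeff (right_normed s) (if s = x then x' else s) \<noteq> (0::'k)"
    proof cases
      case 1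
      then show ?thesis using uv(1) neq(2) words by simp
    next
      case 2
      then show ?thesis using uv(2) neq(3) words by simp
    next
      case 3
      then show ?thesis using x' words by simp
    qed
    then show "length s = Suc (Suc n)" "set s \<subseteq> {..<2}"
      "tree_coeff (right_normed s) (if s = x then x' else s) \<noteq> (0::'k)" by blast+
  qed simp
qed

lemma no_metric_heisenberg: "\<not> metric_pullback 2 2 (b :: (nat magma \<Rightarrow>\<^sub>0 'k::field_char_0) \<Rightarrow> _)"
proof
  assume "metric_pullback 2 2 b"
  then have b: "metric_pullback 2 (Suc 1) b" by (simp add: numeral_2_eq_2)
  let ?e = "\<lambda>i::nat. Poly_Mapping.single (Gen i) (1::'k)"
  let ?z = "magma_mult (?e 0) (?e 1)"
  have F: "?e i \<in> carrier (free_nonassoc {..<2})" if "i < 2" for i :: nat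
    using that by (simp add: single_in_carrier)
  have z: "?z \<in> cd_preimage 2 1"
    using bracket_in_cd_preimage[of "?e 0" 2 "?e 1" 0] F by (simp add: cd_preimage_0)
  have "?z \<in> cd_preimage 2 (Suc 1)"
  proof (rule last_term_in_radical[OF b z])
    fix i :: nat assume "i < 2"
    then consider "i = 0" | "i = 1" by linarith
    then show "b (?e i) ?z = 0"
    proof cases
      case 1
      have "b ?z (?e 0) = - b (?e 1) (magma_mult (?e 0) (?e 0))"
        using F by (intro metric_pullbackD(4)[OF b]) auto
      also have "\<dots> = - b (magma_mult (?e 0) (?e 0)) (?e 1)"
        using F by (subst metric_pullbackD(2)[OF b]) (auto simp: carrier_free_nonassoc_closed)
      also have "\<dots> = 0"
        using F by (subst metric_pullbackD(5)[OF b]) (auto simp: carrier_free_nonassoc_closed square_in_cd_preimage)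
      finally show ?thesis
        using 1 F metric_pullbackD(2)[OF b, of "?e 0" ?z] by (simp add: carrier_free_nonassoc_closed)
    next
      case 2
      \<comment> \<open>Invariance makes this value its own negative in view of symmetry; 2 is
        invertible.\<close>
      have "b ?z (?e 1) = - b (?e 1) ?z"
        using F by (intro metric_pullbackD(4)[OF b]) auto
      moreover have "b ?z (?e 1) = b (?e 1) ?z"
        using F by (intro metric_pullbackD(2)[OF b]) (auto simp: carrier_free_nonassoc_closed)
      ultimately have "2 * b (?e 1) ?z = 0"
        unfolding mult_2 by (metis add.left_inverse)
      then show ?thesis using 2 by simp
    qed
  qed
  then have "word_coeff ?z [0, 1] = 0"
    by (rule word_coeff_cd_preimage) simp
  then show False
    by (simp add: magma_mult_single)
qed


section \<open>The two metrics\<close>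

lemma cd_preimage_diff:
  assumes "f \<in> cd_preimage m r" "g \<in> cd_preimage m r"
  shows "f - g \<in> cd_preimage m r"
proof -
  have eq: "f - g = f + Poly_Mapping.map ((*) (-1)) g"
    by (intro poly_mapping_eqI) (simp add: lookup_add lookup_minus lookup_scale)
  show ?thesis
    unfolding eq using assms by (intro cd_preimage_add cd_preimage_smul)
qed

text \<open>Polarisation of the relation that squares vanish.\<close>

lemma antisym_in_cd_preimage:
  assumes "f \<in> carrier (free_nonassoc {..<m})" "g \<in> carrier (free_nonassoc {..<m})"
  shows "magma_mult f g + magma_mult g f \<in> cd_preimage m k"
proof -
  have "magma_mult f g + magma_mult g f
      = magma_mult (f + g) (f + g) - magma_mult f f - magma_mult g g"
    by (intro poly_mapping_eqI)
       (simp add: lookup_add lookup_minus lookup_magma_mult algebra_simps split: magma.split)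
  then show ?thesis
    using assms by (simp add: cd_preimage_diff square_in_cd_preimage carrier_free_nonassoc_closed)
qed

lemma tree_swap_in_cd_preimage:
  assumes "leaves s \<subseteq> {..<m}" "leaves t \<subseteq> {..<m}"
  shows "Poly_Mapping.single (Prod s t) (1::'k::field) + Poly_Mapping.single (Prod t s) 1
    \<in> cd_preimage m k"
  using antisym_in_cd_preimage[OF single_in_carrier single_in_carrier, OF assms, of "1::'k" 1]
  by (simp add: magma_mult_single)

lemma tree_swap_iff:
  assumes "leaves s \<subseteq> {..<m}" "leaves t \<subseteq> {..<m}"
  shows "Poly_Mapping.single (Prod s t) (1::'k::field) \<in> cd_preimage m k
    \<longleftrightarrow> Poly_Mapping.single (Prod t s) (1::'k) \<in> cd_preimage m k"
  using cd_preimage_diff[OF tree_swap_in_cd_preimage[OF assms], where 'a = 'k]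
    cd_preimage_diff[OF tree_swap_in_cd_preimage[OF assms(2,1)], where 'a = 'k]
  by (metis add_diff_cancel_right')

lemma tree_Prod_in_cd_preimage:
  assumes "leaves s \<subseteq> {..<m}" "Poly_Mapping.single t (1::'k::field) \<in> cd_preimage m r"
  shows "Poly_Mapping.single (Prod s t) (1::'k) \<in> cd_preimage m (Suc r)"
  using bracket_in_cd_preimage[OF single_in_carrier assms(2), of s 1] assms(1)
  by (simp add: magma_mult_single)

lemma tree2_in_cd_preimage:
  "leaves (Prod s t) \<subseteq> {..<m} \<Longrightarrow> Poly_Mapping.single (Prod s t) (1::'k::field) \<in> cd_preimage m 1"
  using tree_Prod_in_cd_preimage[of s m t 0] by (simp add: cd_preimage_0 single_in_carrier)

lemma tree3_in_cd_preimage: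
  assumes "leaves (Prod s (Prod t u)) \<subseteq> {..<m}"
  shows "Poly_Mapping.single (Prod s (Prod t u)) (1::'k::field) \<in> cd_preimage m 2"
    and "Poly_Mapping.single (Prod (Prod t u) s) (1::'k) \<in> cd_preimage m 2"
  using tree_Prod_in_cd_preimage[of s m "Prod t u" 1] tree2_in_cd_preimage[of t u m, where 'k = 'k]
    tree_swap_iff[of s m "Prod t u" 2, where 'k = 'k] assms
  by (auto simp: numeral_2_eq_2)

text \<open>These are the five shapes of a product of four factors. The factors are arbitrary trees,
  so every tree with at least four leaves is covered.\<close>

lemma tree4_in_cd_preimage:
  assumes "leaves s \<union> leaves t \<union> leaves u \<union> leaves v \<subseteq> {..<m}"
  shows "Poly_Mapping.single (Prod s (Prod t (Prod u v))) (1::'k::field) \<in> cd_preimage m 3"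
    and "Poly_Mapping.single (Prod s (Prod (Prod u v) t)) (1::'k) \<in> cd_preimage m 3"
    and "Poly_Mapping.single (Prod (Prod t (Prod u v)) s) (1::'k) \<in> cd_preimage m 3"
    and "Poly_Mapping.single (Prod (Prod (Prod u v) t) s) (1::'k) \<in> cd_preimage m 3"
    and "Poly_Mapping.single (Prod (Prod s t) (Prod u v)) (1::'k) \<in> cd_preimage m 3"
proof -
  note 3 = tree3_in_cd_preimage[where m = m and 'k = 'k]
  have 4: "Poly_Mapping.single (Prod a (Prod b (Prod c d))) (1::'k) \<in> cd_preimage m 3"
    "Poly_Mapping.single (Prod a (Prod (Prod c d) b)) (1::'k) \<in> cd_preimage m 3"
    if "leaves a \<union> leaves b \<union> leaves c \<union> leaves d \<subseteq> {..<m}" for a b c d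
    using tree_Prod_in_cd_preimage[of a m _ 2, where 'k = 'k] 3[of b c d] that
    by (auto simp: numeral_2_eq_2 numeral_3_eq_3)
  show "Poly_Mapping.single (Prod s (Prod t (Prod u v))) (1::'k) \<in> cd_preimage m 3"
    and "Poly_Mapping.single (Prod s (Prod (Prod u v) t)) (1::'k) \<in> cd_preimage m 3"
    and "Poly_Mapping.single (Prod (Prod t (Prod u v)) s) (1::'k) \<in> cd_preimage m 3"
    and "Poly_Mapping.single (Prod (Prod (Prod u v) t) s) (1::'k) \<in> cd_preimage m 3"
    using assms 4[of s t u v] tree_swap_iff[of s m _ 3, where 'k = 'k] by auto
  let ?x = "Prod s t"
  let ?j = "Poly_Mapping.single (Prod ?x (Prod u v)) (1::'k)"
  let ?r = "Poly_Mapping.single (Prod u (Prod v ?x)) (1::'k) + Poly_Mapping.single (Prod v (Prod ?x u)) 1"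
  \<comment> \<open>Jacobi trades the balanced shape for two of the unbalanced shapes treated
    above.\<close>
  have "?j + ?r \<in> cd_preimage m 3"
    using jacobi_in_cd_preimage[OF single_in_carrier single_in_carrier single_in_carrier,
        of ?x m u v "1::'k" 1 1 3] assms
    by (simp add: magma_mult_single)
  moreover have "?r \<in> cd_preimage m 3"
    using 4(1)[of u v s t] 4(2)[of v u s t] assms by (intro cd_preimage_add) auto
  ultimately show "?j \<in> cd_preimage m 3"
    using cd_preimage_diff by fastforce
qed

text \<open>On a word \<open>[i, i]\<close> the two products in a commutator agree. This removes the
  terms with \<open>[0, 0]\<close> and \<open>[1, 1]\<close> when brackets are evaluated on words of
  length three.\<close>

lemma word_coeff_doubled: "word_coeff (f :: 'x magma \<Rightarrow>\<^sub>0 'k::field) [i, i] = 0"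
proof -
  have "tree_coeff t [i, i] = (0::'k)" for t
    by (cases t) auto
  then show ?thesis by (simp add: word_coeff_def)
qed

text \<open>The spanning half of a basis statement: if trees agree with their normal forms modulo
  C^k, then an element whose coordinates all vanish is zero in the quotient.\<close>

lemma normal_form_mod_cd_preimage:
  fixes nf :: "(nat magma \<Rightarrow>\<^sub>0 'k::field) \<Rightarrow> (nat magma \<Rightarrow>\<^sub>0 'k)"
  assumes add: "\<And>f g. nf (f + g) = nf f + nf g"
    and smul: "\<And>c f. nf (Poly_Mapping.map ((*) c) f) = Poly_Mapping.map ((*) c) (nf f)"
    and tree: "\<And>t. leaves t \<subseteq> {..<m} \<Longrightarrow>
      Poly_Mapping.single t 1 - nf (Poly_Mapping.single t 1) \<in> cd_preimage m k"
    and f: "f \<in> carrier (free_nonassoc {..<m})" "nf f = 0"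
  shows "f \<in> cd_preimage m k"
proof -
  have "f - nf f \<in> cd_preimage m k"
    using f(1)
  proof (induction f rule: free_nonassoc_induct)
    case zero
    have "nf 0 = 0" using add[of 0 0] by simp
    then show ?case by (simp add: cd_preimage_zero)
  next
    case (add f g)
    have eq: "(f + g) - nf (f + g) = (f - nf f) + (g - nf g)"
      by (simp add: assms(1))
    show ?case
      unfolding eq using add by (intro cd_preimage_add)
  next
    case (smul c f)
    have eq: "Poly_Mapping.map ((*) c) f - nf (Poly_Mapping.map ((*) c) f) = Poly_Mapping.map ((*) c) (f - nf f)"
      by (simp add: assms(2) map_scale_diff)
    show ?case
      unfolding eq using smul by (intro cd_preimage_smul)
  qed (rule tree)
  then show ?thesis using f by simp
qed

section \<open>The metric on n_{3,2}\<close>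

text \<open>The six words are dual to the six trees. The cyclic choice of \<open>[2, 0]\<close>
  instead of \<open>[0, 2]\<close> keeps the metric free of signs.\<close>

definition nf32 :: "(nat magma \<Rightarrow>\<^sub>0 'k::field) \<Rightarrow> (nat magma \<Rightarrow>\<^sub>0 'k)" where
  "nf32 f = Poly_Mapping.single (Gen 0) (word_coeff f [0])
     + Poly_Mapping.single (Gen 1) (word_coeff f [1])
     + Poly_Mapping.single (Gen 2) (word_coeff f [2])
     + Poly_Mapping.single (Prod (Gen 0) (Gen 1)) (word_coeff f [0, 1])
     + Poly_Mapping.single (Prod (Gen 1) (Gen 2)) (word_coeff f [1, 2])
     + Poly_Mapping.single (Prod (Gen 2) (Gen 0)) (word_coeff f [2, 0])"

lemma nf32_cd_preimage:
  assumes "f \<in> cd_preimage m 2"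
  shows "nf32 f = 0"
  by (simp add: nf32_def word_coeff_cd_preimage[OF assms])

lemma nf32_linear:
  "nf32 (f + g) = nf32 f + nf32 g"
  "nf32 (Poly_Mapping.map ((*) c) f) = Poly_Mapping.map ((*) c) (nf32 f)"
  by (simp_all add: nf32_def single_add map_scale_add map_scale_single)

lemma nf32_tree:
  assumes "leaves t \<subseteq> {..<3}"
  shows "Poly_Mapping.single t (1::'k::field) - nf32 (Poly_Mapping.single t 1) \<in> cd_preimage 3 2"
    (is "?P t")
proof -
  have cd: "?P t" if "Poly_Mapping.single t (1::'k) \<in> cd_preimage 3 2" for t
    using that nf32_cd_preimage by fastforce
  have lt3: "i = 0 \<or> i = 1 \<or> i = 2" if "i < 3" for i :: nat
    using that by auto
  show ?thesis
  proof (cases t)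
    case (Gen i)
    then have "i = 0 \<or> i = 1 \<or> i = 2" using assms lt3 by simp
    then show ?thesis
      unfolding Gen by (elim disjE) (simp_all add: nf32_def cd_preimage_zero)
  next
    case (Prod s u)
    show ?thesis
    proof (cases s)
      case s: (Prod s1 s2)
      show ?thesis
        using assms unfolding Prod s by (intro cd tree3_in_cd_preimage) auto
    next
      case s: (Gen i)
      show ?thesis
      proof (cases u)
        case u: (Prod u1 u2)
        show ?thesis
          using assms unfolding Prod u by (intro cd tree3_in_cd_preimage) auto
      next
        case u: (Gen j)
        have sq: "Poly_Mapping.single (Prod (Gen i) (Gen i)) (1::'k) \<in> cd_preimage 3 2" if "i < 3" for i
          using square_in_cd_preimage[of "Poly_Mapping.single (Gen i) (1::'k)" 3 2] that
          by (simp add: magma_mult_single single_in_carrier)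
        have sw: "Poly_Mapping.single (Prod (Gen i) (Gen j)) (1::'k) + Poly_Mapping.single (Prod (Gen j) (Gen i)) 1
            \<in> cd_preimage 3 2" if "i < 3" "j < 3" for i j
          using tree_swap_in_cd_preimage[of "Gen i" 3 "Gen j"] that by simp
        have "i = 0 \<or> i = 1 \<or> i = 2" "j = 0 \<or> j = 1 \<or> j = 2"
          using assms lt3 Prod s u by auto
        \<comment> \<open>For a reversed pair the normal form is minus the cyclic bracket, so the
          difference to be treated is the sum in \<open>sw\<close>.\<close>
        then show ?thesis
          unfolding Prod s u using sq[of 0] sq[of 1] sq[of 2] sw[of 1 0] sw[of 2 1] sw[of 0 2]
          by (elim disjE) (simp_all add: nf32_def cd_preimage_zero single_uminus)
      qed
    qed
  qed
qed

text \<open>Invariance holds because the product of [f,g] with h is the determinant of the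
  degree-one coordinates of f, g and h, which changes sign when g and h are exchanged.\<close>

lemma metric_3_2:
  "\<exists>b :: (nat magma \<Rightarrow>\<^sub>0 'k::field) \<Rightarrow> _ \<Rightarrow> 'k. metric_pullback 3 2 b"
proof -
  define c :: "(nat magma \<Rightarrow>\<^sub>0 'k) \<Rightarrow> nat list \<Rightarrow> 'k" where "c = word_coeff"
  define b :: "(nat magma \<Rightarrow>\<^sub>0 'k) \<Rightarrow> _ \<Rightarrow> 'k" where
    "b f g = c f [0] * c g [1, 2] + c f [1] * c g [2, 0] + c f [2] * c g [0, 1]
       + c g [0] * c f [1, 2] + c g [1] * c f [2, 0] + c g [2] * c f [0, 1]" for f g
  have rad: "f \<in> cd_preimage 3 2"
    if f: "f \<in> carrier (free_nonassoc {..<3})" and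
      0: "\<And>g. g \<in> carrier (free_nonassoc {..<3}) \<Longrightarrow> b f g = 0" for f
  proof -
    have t: "b f (Poly_Mapping.single t 1) = 0" if "leaves t \<subseteq> {..<3}" for t
      using that by (intro 0 single_in_carrier)
    \<comment> \<open>Pairing with each of the six basis trees isolates one coordinate of
      \<open>f\<close>.\<close>
    have "nf32 f = 0"
      using t[of "Gen 0"] t[of "Gen 1"] t[of "Gen 2"]
        t[of "Prod (Gen 0) (Gen 1)"] t[of "Prod (Gen 1) (Gen 2)"] t[of "Prod (Gen 2) (Gen 0)"]
      by (simp add: b_def c_def nf32_def)
    from f this show ?thesis
      by (intro normal_form_mod_cd_preimage[where nf = nf32, OF nf32_linear nf32_tree])
  qed
  have rad': "b f g = 0" if "f \<in> cd_preimage 3 2" for f g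
    using word_coeff_cd_preimage[OF that] by (simp add: b_def c_def)
  have c_add: "c (f + g) w = c f w + c g w" for f g w
    by (simp add: c_def)
  have c_smul: "c (Poly_Mapping.map ((*) a) f) w = a * c f w" for a f w
    by (simp add: c_def)
  have add: "b (f + g) h = b f h + b g h" for f g h
    unfolding b_def c_add by (simp add: algebra_simps)
  have smul: "b (Poly_Mapping.map ((*) a) f) g = a * b f g" for a f g
    unfolding b_def c_smul by (simp add: algebra_simps)
  have sym: "b f g = b g f" for f g
    unfolding b_def by (simp add: algebra_simps)
  have br: "c (magma_mult f g) [i] = 0"
    "c (magma_mult f g) [i, j] = c f [i] * c g [j] - c g [i] * c f [j]" for f g i j
    by (simp_all add: c_def word_coeff_bracket)
  have inv: "b (magma_mult f g) h + b g (magma_mult f h) = 0" for f g h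
    unfolding b_def br by (simp add: algebra_simps)
  have "metric_pullback 3 2 b"
    unfolding metric_pullback_def Let_def
    by (intro conjI ballI allI iffI add smul sym inv) (rule rad, assumption, erule (1) bspec, erule rad')
  then show ?thesis by blast
qed

section \<open>The metric on n_{2,3}\<close>

text \<open>The minus sign is due to [x_1,[x_0,x_1]], in which the word \<open>[0, 1, 1]\<close> has
  coefficient -1.\<close>

definition nf23 :: "(nat magma \<Rightarrow>\<^sub>0 'k::field) \<Rightarrow> (nat magma \<Rightarrow>\<^sub>0 'k)" where
  "nf23 f = Poly_Mapping.single (Gen 0) (word_coeff f [0])
     + Poly_Mapping.single (Gen 1) (word_coeff f [1])
     + Poly_Mapping.single (Prod (Gen 0) (Gen 1)) (word_coeff f [0, 1])
     + Poly_Mapping.single (Prod (Gen 0) (Prod (Gen 0) (Gen 1))) (word_coeff f [0, 0, 1])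
     - Poly_Mapping.single (Prod (Gen 1) (Prod (Gen 0) (Gen 1))) (word_coeff f [0, 1, 1])"

lemma nf23_cd_preimage:
  assumes "f \<in> cd_preimage m 3"
  shows "nf23 f = 0"
  by (simp add: nf23_def word_coeff_cd_preimage[OF assms])

lemma nf23_linear:
  "nf23 (f + g) = nf23 f + nf23 g"
  "nf23 (Poly_Mapping.map ((*) c) f) = Poly_Mapping.map ((*) c) (nf23 f)"
  by (simp_all add: nf23_def single_add map_scale_add map_scale_diff map_scale_single)

lemma nf23_tree:
  assumes "leaves t \<subseteq> {..<2}"
  shows "Poly_Mapping.single t (1::'k::field) - nf23 (Poly_Mapping.single t 1) \<in> cd_preimage 2 3"
    (is "?P t")
proof -
  let ?e = "\<lambda>t. Poly_Mapping.single t (1::'k)"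
  have cd: "?P t" if "?e t \<in> cd_preimage 2 3" for t
    using that nf23_cd_preimage by fastforce
  have lt2: "i = 0 \<or> i = 1" if "i < 2" for i :: nat
    using that by auto
  \<comment> \<open>Since \<open>nf23\<close> vanishes on C^3, trees that are opposite modulo C^3
    have opposite normal forms, and the congruence passes from one to the other.\<close>
  have opp: "?P u" if t: "?P t" and s: "?e t + ?e u \<in> cd_preimage 2 3" for t u
  proof -
    have "nf23 (?e t) + nf23 (?e u) = 0"
      using nf23_cd_preimage[OF s] by (simp add: nf23_linear)
    then have eq: "?e u - nf23 (?e u) = (?e t + ?e u) - (?e t - nf23 (?e t))"
      by (simp add: algebra_simps eq_neg_iff_add_eq_0)
    show ?thesis
      unfolding eq by (rule cd_preimage_diff[OF s t])
  qed
  have swap: "?P (Prod u t)" if "?P (Prod t u)" "leaves t \<subseteq> {..<2}" "leaves u \<subseteq> {..<2}" for t u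
    using that by (intro opp[OF that(1)] tree_swap_in_cd_preimage)
  have sq: "?e (Prod (Gen i) (Gen i)) \<in> cd_preimage 2 r" if "i < 2" for i r
    using square_in_cd_preimage[of "?e (Gen i)" 2 r] that
    by (simp add: magma_mult_single single_in_carrier)
  have gen: "?P (Gen i)" if "i < 2" for i
    using lt2[OF that] by (elim disjE) (simp_all add: nf23_def cd_preimage_zero)
  have gg: "?P (Prod (Gen i) (Gen j))" if ij: "i < 2" "j < 2" for i j
  proof -
    have 01: "?P (Prod (Gen 0) (Gen 1))"
      by (simp add: nf23_def cd_preimage_zero)
    then have "?P (Prod (Gen 1) (Gen 0))"
      by (rule swap) auto
    then show ?thesis
      using lt2[OF ij(1)] lt2[OF ij(2)] 01 cd[OF sq[OF ij(1)]] by (elim disjE) simp_all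
  qed
  have ggg: "?P (Prod (Gen l) (Prod (Gen i) (Gen j)))" if ij: "i < 2" "j < 2" "l < 2" for i j l
  proof -
    have 01: "?P (Prod (Gen l) (Prod (Gen 0) (Gen 1)))"
      using lt2[OF ij(3)] by (elim disjE) (simp_all add: nf23_def cd_preimage_zero single_uminus)
    have 10: "?P (Prod (Gen l) (Prod (Gen 1) (Gen 0)))"
    proof (rule opp[OF 01])
      \<comment> \<open>Bracketing the antisymmetry relation of the inner pair with a generator
        gives the relation between the two outer trees.\<close>
      have "magma_mult (?e (Gen l)) (?e (Prod (Gen 0) (Gen 1)) + ?e (Prod (Gen 1) (Gen 0)))
          \<in> cd_preimage 2 (Suc 2)"
        using ij by (intro bracket_in_cd_preimage tree_swap_in_cd_preimage single_in_carrier) auto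
      also have "magma_mult (?e (Gen l)) (?e (Prod (Gen 0) (Gen 1)) + ?e (Prod (Gen 1) (Gen 0)))
          = ?e (Prod (Gen l) (Prod (Gen 0) (Gen 1))) + ?e (Prod (Gen l) (Prod (Gen 1) (Gen 0)))"
        by (intro poly_mapping_eqI)
           (auto simp: lookup_magma_mult lookup_add lookup_single when_def split: magma.split)
      finally show "?e (Prod (Gen l) (Prod (Gen 0) (Gen 1))) + ?e (Prod (Gen l) (Prod (Gen 1) (Gen 0)))
          \<in> cd_preimage 2 3"
        by (simp add: numeral_3_eq_3 numeral_2_eq_2)
    qed
    have "?P (Prod (Gen l) (Prod (Gen i) (Gen i)))" if "i < 2" for i
      using tree_Prod_in_cd_preimage[of "Gen l" 2 "Prod (Gen i) (Gen i)" 2, where 'k = 'k] sq[OF that] ij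
      by (intro cd) (simp add: numeral_3_eq_3 numeral_2_eq_2)
    then show ?thesis
      using lt2[OF ij(1)] lt2[OF ij(2)] 01 10 by (elim disjE) simp_all
  qed
  have gp: "?P (Prod (Gen i) (Prod s u))" if "i < 2" "leaves s \<union> leaves u \<subseteq> {..<2}" for i s u
  proof (cases s)
    case s: (Gen j)
    show ?thesis
    proof (cases u)
      case (Gen l)
      then show ?thesis using that s ggg by simp
    next
      case u: (Prod u1 u2)
      show ?thesis using that unfolding u by (intro cd tree4_in_cd_preimage) auto
    qed
  next
    case s: (Prod s1 s2)
    show ?thesis using that unfolding s by (intro cd tree4_in_cd_preimage) auto
  qed
  show ?thesis
  proof (cases t)
    case (Gen i)
    then show ?thesis using gen assms by simp
  next
    case (Prod s u)
    show ?thesis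
    proof (cases s)
      case s: (Gen i)
      show ?thesis
        using assms Prod s gg[of i] gp[of i] by (cases u) auto
    next
      case s: (Prod s1 s2)
      show ?thesis
      proof (cases u)
        case u: (Gen i)
        show ?thesis
          unfolding Prod s u by (rule swap) (use assms gp[of i s1 s2] Prod s u in auto)
      next
        case u: (Prod u1 u2)
        show ?thesis
          using assms unfolding Prod s u by (intro cd tree4_in_cd_preimage) auto
      qed
    qed
  qed
qed

text \<open>Once [x,y] has square 1, invariance forces the other values: 1 equals minus the product
  of y with [x,[x,y]], and also the product of x with [y,[x,y]]. In word coordinates both cross
  terms get a minus sign, because \<open>[0, 1, 1]\<close> has coefficient -1 in [y,[x,y]] and
  \<open>[0, 0, 1]\<close> has coefficient 1 in [x,[x,y]].\<close>

lemma metric_2_3: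
  "\<exists>b :: (nat magma \<Rightarrow>\<^sub>0 'k::field) \<Rightarrow> _ \<Rightarrow> 'k. metric_pullback 2 3 b"
proof -
  define c :: "(nat magma \<Rightarrow>\<^sub>0 'k) \<Rightarrow> nat list \<Rightarrow> 'k" where "c = word_coeff"
  define b :: "(nat magma \<Rightarrow>\<^sub>0 'k) \<Rightarrow> _ \<Rightarrow> 'k" where
    "b f g = c f [0, 1] * c g [0, 1] - c f [0] * c g [0, 1, 1] - c g [0] * c f [0, 1, 1]
       - c f [1] * c g [0, 0, 1] - c g [1] * c f [0, 0, 1]" for f g
  have rad: "f \<in> cd_preimage 2 3"
    if f: "f \<in> carrier (free_nonassoc {..<2})" and
      0: "\<And>g. g \<in> carrier (free_nonassoc {..<2}) \<Longrightarrow> b f g = 0" for f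
  proof -
    have t: "b f (Poly_Mapping.single t 1) = 0" if "leaves t \<subseteq> {..<2}" for t
      using that by (intro 0 single_in_carrier)
    have "nf23 f = 0"
      using t[of "Gen 0"] t[of "Gen 1"] t[of "Prod (Gen 0) (Gen 1)"]
        t[of "Prod (Gen 0) (Prod (Gen 0) (Gen 1))"] t[of "Prod (Gen 1) (Prod (Gen 0) (Gen 1))"]
      by (simp add: b_def c_def nf23_def)
    from f this show ?thesis
      by (intro normal_form_mod_cd_preimage[where nf = nf23, OF nf23_linear nf23_tree])
  qed
  have rad': "b f g = 0" if "f \<in> cd_preimage 2 3" for f g
    using word_coeff_cd_preimage[OF that] by (simp add: b_def c_def)
  have c_add: "c (f + g) w = c f w + c g w" for f g w
    by (simp add: c_def)
  have c_smul: "c (Poly_Mapping.map ((*) a) f) w = a * c f w" for a f w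
    by (simp add: c_def)
  have add: "b (f + g) h = b f h + b g h" for f g h
    unfolding b_def c_add by (simp add: algebra_simps)
  have smul: "b (Poly_Mapping.map ((*) a) f) g = a * b f g" for a f g
    unfolding b_def c_smul by (simp add: algebra_simps)
  have sym: "b f g = b g f" for f g
    unfolding b_def by (simp add: algebra_simps)
  have br: "c (magma_mult f g) [i] = 0"
    "c (magma_mult f g) [i, j] = c f [i] * c g [j] - c g [i] * c f [j]"
    "c (magma_mult f g) [0, 0, 1] = c f [0] * c g [0, 1] - c g [0] * c f [0, 1]"
    "c (magma_mult f g) [0, 1, 1] = c f [0, 1] * c g [1] - c g [0, 1] * c f [1]" for f g i j
    by (simp_all add: c_def word_coeff_bracket word_coeff_doubled)
  have inv: "b (magma_mult f g) h + b g (magma_mult f h) = 0" for f g h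
    unfolding b_def br by (simp add: algebra_simps)
  have "metric_pullback 2 3 b"
    unfolding metric_pullback_def Let_def
    by (intro conjI ballI allI iffI add smul sym inv) (rule rad, assumption, erule (1) bspec, erule rad')
  then show ?thesis by blast
qed

theorem theorem3p8:
  fixes m k :: nat
  assumes "m \<ge> 2" and "k \<ge> 2"
  shows "admits_ad_invariant_metric
           (free_nilpotent m k :: ('k::field_char_0, (nat magma \<Rightarrow>\<^sub>0 'k) set set) alg)
         \<longleftrightarrow> (m, k) = (3, 2) \<or> (m, k) = (2, 3)"
proof
  assume "admits_ad_invariant_metric
    (free_nilpotent m k :: ('k, (nat magma \<Rightarrow>\<^sub>0 'k) set set) alg)"
  then obtain b :: "(nat magma \<Rightarrow>\<^sub>0 'k) \<Rightarrow> _ \<Rightarrow> 'k" where b: "metric_pullback m k b"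
    by (auto simp: admits_ad_invariant_metric_free_nilpotent)
  have "m = 2 \<and> k = 2 \<or> m = 2 \<and> k = 3 \<or> m = 2 \<and> k \<ge> 4 \<or> m = 3 \<and> k = 2 \<or> m \<ge> 4 \<and> k = 2 \<or> m \<ge> 3 \<and> k \<ge> 3"
    using assms by linarith
  then show "(m, k) = (3, 2) \<or> (m, k) = (2, 3)"
    using b no_metric_heisenberg no_metric_step2 no_metric_step_ge3 no_metric_two_generators by blast
next
  assume "(m, k) = (3, 2) \<or> (m, k) = (2, 3)"
  then show "admits_ad_invariant_metric
      (free_nilpotent m k :: ('k, (nat magma \<Rightarrow>\<^sub>0 'k) set set) alg)"
    using metric_3_2 metric_2_3 by (auto simp: admits_ad_invariant_metric_free_nilpotent)
qed

end
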